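(* Let $G$, $Y\subset(\mathbb{R}_+)^n$, $\nu$, $\mathcal{Y}(Y)$, $\Xi(\hat G)$, $\rho$ and $\mathcal{A}_\mathcal{X}(G\times Y)$ be as in the context. Suppose that there is a continuous function $\wp:C^\infty_c(Y)\to[0,+\infty)$ with $\wp(0)=0$ such that $|v(h)|\le\wp(h)\,\|v\|_\mathcal{Y}$ for all $h\in C^\infty_c(Y)$ and all $v\in\mathcal{Y}(Y)$. If $\rho(\xi)=+\infty$ for all $\xi\in\hat G\setminus\overline{\hat G_+}$, then $$\operatorname{supp}\hat u_0\subset\overline{\hat G_+},\quad\forall u\in\mathcal{A}_\mathcal{X}(G\times Y).$$
   Context: Groups. $G=\prod_{i=1}^nG_i$ with $G_i\in\{\mathbb{R},\mathbb{T}\}$, $\mathbb{T}=\mathbb{R}/\mathbb{Z}$, Haar measure $dx$; dual group $\hat G=\prod_i\hat G_i$ with $\hat{\mathbb{R}}=\mathbb{R}$, $\hat{\mathbb{T}}=\mathbb{Z}$, Haar measure $d\xi$ (Lebesgue/counting). $\overline{\hat G_+}=\prod_{i=1}^n(\hat G_i\cap[0,+\infty))$. $\mathbb{R}_+=(0,+\infty)$, and $Y\subset(\mathbb{R}_+)^n$ is a connected open set with a measure $\nu$ given by a smooth nowhere vanishing positive density; $d\mu(x,y)=dx\,d\nu(y)$. $G\times Y$ is viewed as the complex manifold $G+\imath Y$ with $z_i=x_i+\imath y_i$; $\mathrm{Hol}(G\times Y)$ is the space of holomorphic functions on it. $\langle x,\xi\rangle=\sum_ix_i\xi_i$, $\langle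 y,\xi\rangle=\sum_iy_i\xi_i$; $e^{-2\pi\langle\cdot,\cdot\rangle}$ denotes $(\xi,y)\mapsto e^{-2\pi\langle y,\xi\rangle}$. Distributions and Fourier transform. $\mathcal{S}(\mathbb{R})$ is the Schwartz space, $\mathcal{S}(\mathbb{T})=C^\infty(\mathbb{T})$, $\mathcal{S}(\mathbb{Z})$ the rapidly decaying sequences, $\mathcal{S}(G)$, $\mathcal{S}(\hat G)$ the corresponding completed tensor products. $\mathcal{D}(G\times Y)=\mathcal{S}(G)\hat\otimes C^\infty_c(Y)=\varinjlim_{K\Subset Y}\mathcal{S}(G)\hat\otimes C^\infty_c(K)$ ($C^\infty_c(K)$: smooth functions supported in the compact $K$); similarly $\mathcal{D}(\hat G\times Y)$. Primes denote continuous duals; $\mathcal{D}(\hat G\times Y)'\subset C^\infty_c(\hat G\times Y)'$ by restriction. For $f\in\mathcal{D}(G\times Y)$, $\hat f(\xi,y)=\int_Gf(x,y)e^{-2\pi\imath\langle x,\xi\rangle}dx$; for $u\in\mathcal{D}(G\times Y)'$, $\hat u\in\mathcal{D}(\hat G\times Y)'$ is defined by $\hat u(\hat f)=u(\breve f)$, $\breve f(x,y)=f(-x,y)$. Functions on $G\times Y$, $\hat G$, $Y$ are identified with distributions by integration against $\mu$, $d\xi$, $\nu$. For $\hat u_0\in C^\infty_c(\hat G)'$, $e^{-2\pi\langle\cdot,\cdot\rangle}\hat u_0\in C^\infty_c(\hat G\times Y)'$ is $\hat f\mapsto\int_Y\hat u_0(e^{-2\pi\langle y,\cdot\rangle}\hat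 f(\cdot,y))d\nu(y)$. For every $u\in\mathrm{Hol}(G\times Y)\cap\mathcal{D}(G\times Y)'$ there is a unique $\hat u_0\in C^\infty_c(\hat G)'$ with $\hat u=e^{-2\pi\langle\cdot,\cdot\rangle}\hat u_0$; this is the $\hat u_0$ in the claim. Banach spaces. $\mathcal{Y}(Y)$ is a Banach space continuously embedded in $C^\infty_c(Y)'$, with norm regarded as a $[0,+\infty]$-valued extended norm on $C^\infty_c(Y)'$ ($+\infty$ wherever undefined). $\Xi(\hat G)$ is a Banach space continuously embedded in $\mathcal{S}(\hat G)'$ with $\Xi(\hat G)\subset L^1_{\mathrm{loc}}(\hat G)\cap\mathcal{S}(\hat G)'$. $L^1_{\mathrm{loc}}(\hat G,\mathcal{Y}(Y))$ is the space of locally Bochner-integrable functions, $\hat u$ in it being identified with the distribution $\hat f\mapsto\int_{\hat G}\hat u(\xi)(\hat f(\xi,\cdot))d\xi$. $\Xi(\hat G,\mathcal{Y}(Y))=\{\hat u\in L^1_{\mathrm{loc}}(\hat G,\mathcal{Y}(Y)):\|\hat u(\cdot)\|_\mathcal{Y}\in\Xi(\hat G)\}$, $\mathcal{X}(G\times Y)=\{u\in\mathcal{D}(G\times Y)':\hat u\in\Xi(\hat G,\mathcal{Y}(Y))\}$, $\mathcal{A}_\mathcal{X}(G\times Y)=\mathcal{X}(G\times Y)\cap\mathrm{Hol}(G\times Y)$. $\rho:\hat G\to(0,+\infty]$, $\rho(\xi)=\|e^{-2\pi\langle\cdot,\xi\rangle}\|_\mathcal{Y}$. *)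

theory Defs
  imports "HOL-Analysis.Analysis"
begin

section \<open>The groups\<close>

text \<open>
  A set \<open>T\<close> of indices selects the circle factors: the \<open>i\<close>-th factor of \<open>G\<close> is the circle
  \<open>R/Z\<close> for \<open>i \<in> T\<close> and \<open>R\<close> otherwise.  Functions on \<open>G\<close> are functions on \<open>R^n\<close> that have
  period 1 in the coordinates of \<open>T\<close>; functions on the dual group are functions on \<open>R^n\<close> that
  vanish off the closed subgroup \<open>dual_group T\<close>.
\<close>

definition dual_group :: "'n::finite set \<Rightarrow> (real^'n) set" where
  "dual_group T = {\<xi>. \<forall>i\<in>T. \<xi> $ i \<in> \<int>}"

definition dual_group_nonneg :: "'n::finite set \<Rightarrow> (real^'n) set" where
  "dual_group_nonneg T = {\<xi> \<in> dual_group T. \<forall>i. 0 \<le> \<xi> $ i}"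

definition haar :: "'n::finite set \<Rightarrow> (real^'n) measure" where
  "haar T = restrict_space lborel {x. \<forall>i\<in>T. 0 \<le> x $ i \<and> x $ i < 1}"

text \<open>
  A Borel measure on \<open>R^n\<close> concentrated on \<open>dual_group T\<close>: counting measure on the integers in
  the coordinates of \<open>T\<close>, Lebesgue measure in the others.
\<close>

definition dual_haar :: "'n::finite set \<Rightarrow> (real^'n) measure" where
  "dual_haar T =
     distr (PiM UNIV (\<lambda>i. if i \<in> T then distr (count_space UNIV) borel real_of_int else lborel))
       borel (\<lambda>f. \<chi> i. f i)"

definition periodic_fun :: "'n::finite set \<Rightarrow> ((real^'n) \<times> (real^'n) \<Rightarrow> 'b) set" where
  "periodic_fun T = {f. \<forall>i\<in>T. \<forall>x y. f (x + axis i 1, y) = f (x, y)}"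

section \<open>Smooth functions\<close>

primrec iter_deriv ::
    "'a::real_normed_vector list \<Rightarrow> ('a \<Rightarrow> 'b::real_normed_vector) \<Rightarrow> 'a \<Rightarrow> 'b" where
  "iter_deriv [] f = f"
| "iter_deriv (v # vs) f =
     (\<lambda>x. vector_derivative (\<lambda>t. iter_deriv vs f (x + t *\<^sub>R v)) (at 0))"

text \<open>
  All iterated directional derivatives along \<open>B\<close> exist and are continuous on \<open>S\<close>.  With \<open>S\<close>
  open and \<open>B = Basis\<close> this is the usual notion; with \<open>S\<close> a product of a discrete set and a
  Euclidean space, \<open>B\<close> consists of the Euclidean coordinate directions only.
\<close>

definition smooth_along ::
    "'a::real_normed_vector set \<Rightarrow> 'a set \<Rightarrow> ('a \<Rightarrow> 'b::real_normed_vector) \<Rightarrow> bool" where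
  "smooth_along B S f \<longleftrightarrow>
     (\<forall>vs\<in>lists B. continuous_on S (iter_deriv vs f) \<and>
        (\<forall>x\<in>S. \<forall>v\<in>B. (\<lambda>t. iter_deriv vs f (x + t *\<^sub>R v)) differentiable (at 0)))"

definition smooth_positive_density :: "(real^'n) set \<Rightarrow> (real^'n::finite) measure \<Rightarrow> bool" where
  "smooth_positive_density Y \<nu> \<longleftrightarrow>
     (\<exists>\<kappa>::real^'n \<Rightarrow> real. smooth_along Basis Y \<kappa> \<and> (\<forall>y\<in>Y. 0 < \<kappa> y) \<and>
        \<nu> = density lborel (\<lambda>y. ennreal (\<kappa> y) * indicator Y y))"

section \<open>Inductive limits of Frechet spaces and their duals\<close>

text \<open>
  A space of test functions is presented by the family of its step spaces (all with the
  seminorms induced by one increasing sequence of seminorms); it carries the finest locally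
  convex topology for which the inclusions of the steps are continuous.
\<close>

type_synonym 'a lf = "('a \<Rightarrow> complex) set set \<times> (nat \<Rightarrow> ('a \<Rightarrow> complex) \<Rightarrow> real)"

type_synonym 'a functional = "('a \<Rightarrow> complex) \<Rightarrow> complex"

definition lf_space :: "'a lf \<Rightarrow> ('a \<Rightarrow> complex) set" where
  "lf_space F = \<Union>(fst F)"

definition lf_seminorms :: "'a lf \<Rightarrow> (('a \<Rightarrow> complex) \<Rightarrow> real) set" where
  "lf_seminorms F = {p.
     (\<forall>f\<in>lf_space F. 0 \<le> p f) \<and>
     (\<forall>f\<in>lf_space F. \<forall>c. p (\<lambda>x. c * f x) = cmod c * p f) \<and>
     (\<forall>f\<in>lf_space F. \<forall>g\<in>lf_space F. p (\<lambda>x. f x + g x) \<le> p f + p g) \<and>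
     (\<forall>E\<in>fst F. \<exists>C k. \<forall>f\<in>E. p f \<le> C * snd F k f)}"

definition lf_topology :: "'a lf \<Rightarrow> ('a \<Rightarrow> complex) topology" where
  "lf_topology F = topology_generated_by
     {{g \<in> lf_space F. p (\<lambda>x. g x - f x) < e} | p f e.
        p \<in> lf_seminorms F \<and> f \<in> lf_space F \<and> 0 < e}"

definition lf_bounded :: "'a lf \<Rightarrow> ('a \<Rightarrow> complex) set \<Rightarrow> bool" where
  "lf_bounded F A \<longleftrightarrow> A \<subseteq> lf_space F \<and> (\<forall>p\<in>lf_seminorms F. bdd_above (p ` A))"

text \<open>
  Functionals are total functions, normalised to be 0 outside the test function space, so that
  equality of elements of the dual is equality in HOL.
\<close>

definition lf_dual :: "'a lf \<Rightarrow> 'a functional set" where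
  "lf_dual F = {u.
     (\<forall>f\<in>lf_space F. \<forall>g\<in>lf_space F. u (\<lambda>x. f x + g x) = u f + u g) \<and>
     (\<forall>f\<in>lf_space F. \<forall>c. u (\<lambda>x. c * f x) = c * u f) \<and>
     continuous_map (lf_topology F) euclidean u \<and>
     (\<forall>f. f \<notin> lf_space F \<longrightarrow> u f = 0)}"

section \<open>Spaces of test functions\<close>

definition decay_terms ::
    "'a::real_normed_vector set \<Rightarrow> ('a \<Rightarrow> real) \<Rightarrow> nat \<Rightarrow> ('a \<Rightarrow> complex) \<Rightarrow> real set" where
  "decay_terms B w k f =
     {w x ^ k * cmod (iter_deriv vs f x) | x vs. vs \<in> lists B \<and> length vs \<le> k}"

text \<open>
  Arguments: the ambient set \<open>A\<close> of functions, the closed set \<open>S\<close> carrying the functions, the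
  directions \<open>B\<close> of differentiation, the weight \<open>w \<ge> 1\<close> measuring decay, and the family of
  admissible supports.  The completed tensor products of Schwartz spaces and spaces of compactly
  supported smooth functions are realised as the corresponding spaces of functions on products.
\<close>

definition test_lf ::
    "('a::real_normed_vector \<Rightarrow> complex) set \<Rightarrow> 'a set \<Rightarrow> 'a set \<Rightarrow> ('a \<Rightarrow> real) \<Rightarrow> 'a set set \<Rightarrow> 'a lf"
  where
  "test_lf A S B w \<K> =
     ((\<lambda>K. {f \<in> A. smooth_along B S f \<and> (\<forall>x. x \<notin> K \<longrightarrow> f x = 0) \<and>
                (\<forall>k. bdd_above (decay_terms B w k f))}) ` \<K>,
      \<lambda>k f. Sup (decay_terms B w k f))"

definition dual_dirs :: "'n::finite set \<Rightarrow> (real^'n) set" where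
  "dual_dirs T = (\<lambda>i. axis i 1) ` (- T)"

definition dual_prod_dirs :: "'n::finite set \<Rightarrow> ((real^'n) \<times> (real^'n)) set" where
  "dual_prod_dirs T = (\<lambda>v. (v, 0)) ` dual_dirs T \<union> (\<lambda>v. (0, v)) ` Basis"

definition Cc_Y :: "(real^'n::finite) set \<Rightarrow> (real^'n) lf" where
  "Cc_Y Y = test_lf UNIV UNIV Basis (\<lambda>_. 1) {K. compact K \<and> K \<subseteq> Y}"

definition Cc_dual :: "'n::finite set \<Rightarrow> (real^'n) lf" where
  "Cc_dual T = test_lf UNIV (dual_group T) (dual_dirs T) (\<lambda>_. 1)
     {K. compact K \<and> K \<subseteq> dual_group T}"

definition S_dual :: "'n::finite set \<Rightarrow> (real^'n) lf" where
  "S_dual T = test_lf UNIV (dual_group T) (dual_dirs T) (\<lambda>\<xi>. 1 + norm \<xi>) {dual_group T}"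

definition Cc_dual_prod ::
    "'n::finite set \<Rightarrow> (real^'n) set \<Rightarrow> ((real^'n) \<times> (real^'n)) lf" where
  "Cc_dual_prod T Y = test_lf UNIV (dual_group T \<times> UNIV) (dual_prod_dirs T) (\<lambda>_. 1)
     {K. compact K \<and> K \<subseteq> dual_group T \<times> Y}"

definition D_dual_prod ::
    "'n::finite set \<Rightarrow> (real^'n) set \<Rightarrow> ((real^'n) \<times> (real^'n)) lf" where
  "D_dual_prod T Y =
     test_lf UNIV (dual_group T \<times> UNIV) (dual_prod_dirs T) (\<lambda>(\<xi>, y). 1 + norm \<xi>)
       {dual_group T \<times> K | K. compact K \<and> K \<subseteq> Y}"

definition Cc_prod ::
    "'n::finite set \<Rightarrow> (real^'n) set \<Rightarrow> ((real^'n) \<times> (real^'n)) lf" where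
  "Cc_prod T Y = test_lf (periodic_fun T) UNIV Basis (\<lambda>_. 1)
     {{x. \<forall>i. i \<notin> T \<longrightarrow> \<bar>x $ i\<bar> \<le> r} \<times> K | r K. compact K \<and> K \<subseteq> Y}"

definition D_prod ::
    "'n::finite set \<Rightarrow> (real^'n) set \<Rightarrow> ((real^'n) \<times> (real^'n)) lf" where
  "D_prod T Y = test_lf (periodic_fun T) UNIV Basis (\<lambda>(x, y). 1 + (\<Sum>i\<in>-T. \<bar>x $ i\<bar>))
     {UNIV \<times> K | K. compact K \<and> K \<subseteq> Y}"

section \<open>Fourier transform\<close>

definition fourier_fun ::
    "'n::finite set \<Rightarrow> ((real^'n) \<times> (real^'n) \<Rightarrow> complex) \<Rightarrow> (real^'n) \<times> (real^'n) \<Rightarrow> complex" where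
  "fourier_fun T f = (\<lambda>(\<xi>, y).
     if \<xi> \<in> dual_group T then \<integral>x. f (x, y) * exp (- 2 * pi * \<i> * of_real (x \<bullet> \<xi>)) \<partial>haar T else 0)"

definition breve :: "((real^'n) \<times> (real^'n) \<Rightarrow> complex) \<Rightarrow> (real^'n::finite) \<times> (real^'n) \<Rightarrow> complex"
  where "breve f = (\<lambda>(x, y). f (- x, y))"

definition fourier_dist ::
    "'n::finite set \<Rightarrow> (real^'n) set \<Rightarrow> ((real^'n) \<times> (real^'n)) functional
       \<Rightarrow> ((real^'n) \<times> (real^'n)) functional" where
  "fourier_dist T Y u = (THE v. v \<in> lf_dual (D_dual_prod T Y) \<and>
     (\<forall>f \<in> lf_space (D_prod T Y). v (fourier_fun T f) = u (breve f)))"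

section \<open>Holomorphic functions\<close>

definition holomorphic_prod ::
    "'n::finite set \<Rightarrow> (real^'n) set \<Rightarrow> ((real^'n) \<times> (real^'n) \<Rightarrow> complex) \<Rightarrow> bool" where
  "holomorphic_prod T Y \<phi> \<longleftrightarrow>
     (\<forall>i\<in>T. \<forall>x. \<forall>y\<in>Y. \<phi> (x + axis i 1, y) = \<phi> (x, y)) \<and>
     (\<forall>x. \<forall>y\<in>Y. \<exists>a::complex^'n.
        (\<phi> has_derivative (\<lambda>(s, t). \<Sum>i\<in>UNIV. a $ i * Complex (s $ i) (t $ i))) (at (x, y)))"

text \<open>
  As for tempered distributions below, a distribution is a given function if they agree on
  compactly supported test functions, which are dense.
\<close>

definition Hol_dist ::
    "'n::finite set \<Rightarrow> (real^'n) set \<Rightarrow> (real^'n) measure \<Rightarrow> ((real^'n) \<times> (real^'n)) functional set"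
  where
  "Hol_dist T Y \<nu> = {u \<in> lf_dual (D_prod T Y). \<exists>\<phi>. holomorphic_prod T Y \<phi> \<and>
     (\<forall>f \<in> lf_space (Cc_prod T Y). u f = (\<integral>p. \<phi> p * f p \<partial>(haar T \<Otimes>\<^sub>M \<nu>)))}"

section \<open>Banach spaces of distributions\<close>

text \<open>
  A Banach space contained in a space of distributions is given by its norm, extended by
  \<open>\<infinity>\<close> to all distributions.
\<close>

definition finite_part :: "'a functional set \<Rightarrow> ('a functional \<Rightarrow> ennreal) \<Rightarrow> 'a functional set" where
  "finite_part V N = {v \<in> V. N v < \<infinity>}"

definition ext_dist :: "('a functional \<Rightarrow> ennreal) \<Rightarrow> 'a functional \<Rightarrow> 'a functional \<Rightarrow> real" where
  "ext_dist N v w = enn2real (N (\<lambda>h. v h - w h))"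

text \<open>
  The last clause is continuity of the inclusion into the dual with its strong topology, the
  topology of uniform convergence on bounded sets.
\<close>

definition embedded_banach :: "'a lf \<Rightarrow> ('a functional \<Rightarrow> ennreal) \<Rightarrow> bool" where
  "embedded_banach F N \<longleftrightarrow>
     (\<forall>v\<in>lf_dual F. N v = 0 \<longleftrightarrow> v = (\<lambda>_. 0)) \<and>
     (\<forall>v\<in>lf_dual F. \<forall>c. N (\<lambda>h. c * v h) = ennreal (cmod c) * N v) \<and>
     (\<forall>v\<in>lf_dual F. \<forall>w\<in>lf_dual F. N (\<lambda>h. v h + w h) \<le> N v + N w) \<and>
     Metric_space.mcomplete (finite_part (lf_dual F) N) (ext_dist N) \<and>
     (\<forall>A. lf_bounded F A \<longrightarrow>
        (\<exists>C. \<forall>v\<in>finite_part (lf_dual F) N. \<forall>h\<in>A. cmod (v h) \<le> C * enn2real (N v)))"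

definition Y_space :: "(real^'n::finite) set \<Rightarrow> ((real^'n) functional \<Rightarrow> ennreal) \<Rightarrow> (real^'n) functional set"
  where "Y_space Y NY = finite_part (lf_dual (Cc_Y Y)) NY"

definition Xi_space :: "'n::finite set \<Rightarrow> ((real^'n) functional \<Rightarrow> ennreal) \<Rightarrow> (real^'n) functional set"
  where "Xi_space T NX = finite_part (lf_dual (S_dual T)) NX"

text \<open>
  A tempered distribution \<open>w\<close> is the function \<open>g\<close> if they agree on compactly supported test
  functions; for a general Schwartz function the integral need not converge absolutely.
\<close>

definition represents :: "'n::finite set \<Rightarrow> (real^'n \<Rightarrow> complex) \<Rightarrow> (real^'n) functional \<Rightarrow> bool" where
  "represents T g w \<longleftrightarrow> (\<forall>f \<in> lf_space (Cc_dual T). w f = (\<integral>\<xi>. g \<xi> * f \<xi> \<partial>dual_haar T))"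

definition L1loc_dual :: "'n::finite set \<Rightarrow> (real^'n \<Rightarrow> complex) set" where
  "L1loc_dual T = {g \<in> borel_measurable borel.
     \<forall>K. compact K \<longrightarrow> set_integrable (dual_haar T) K g}"

definition locally_integrable_dists ::
    "'n::finite set \<Rightarrow> ((real^'n) functional \<Rightarrow> ennreal) \<Rightarrow> bool" where
  "locally_integrable_dists T NX \<longleftrightarrow> (\<forall>w\<in>Xi_space T NX. \<exists>g\<in>L1loc_dual T. represents T g w)"

text \<open>
  Representatives of classes in \<open>L1loc\<close> are chosen to be limits of simple functions at every
  point, not only almost everywhere, and are extended by 0 off the dual group.  The space \<open>Y_space Y NY\<close> need not be separable.
\<close>

definition L1loc_dual_Y ::
    "'n::finite set \<Rightarrow> (real^'n) set \<Rightarrow> ((real^'n) functional \<Rightarrow> ennreal)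
       \<Rightarrow> (real^'n \<Rightarrow> (real^'n) functional) set" where
  "L1loc_dual_Y T Y NY = {U.
     (\<forall>\<xi>\<in>dual_group T. U \<xi> \<in> Y_space Y NY) \<and>
     (\<forall>\<xi>. \<xi> \<notin> dual_group T \<longrightarrow> U \<xi> = (\<lambda>_. 0)) \<and>
     (\<exists>s. (\<forall>k::nat. simple_function (dual_haar T) (s k) \<and>
             (\<forall>\<xi>\<in>dual_group T. s k \<xi> \<in> Y_space Y NY)) \<and>
          (\<forall>\<xi>\<in>dual_group T. (\<lambda>k. ext_dist NY (s k \<xi>) (U \<xi>)) \<longlonglongrightarrow> 0)) \<and>
     (\<forall>K. compact K \<longrightarrow> K \<subseteq> dual_group T \<longrightarrow> (\<integral>\<^sup>+\<xi>\<in>K. NY (U \<xi>) \<partial>dual_haar T) < \<infinity>)}"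

definition Xi_Y_space ::
    "'n::finite set \<Rightarrow> (real^'n) set \<Rightarrow> ((real^'n) functional \<Rightarrow> ennreal)
       \<Rightarrow> ((real^'n) functional \<Rightarrow> ennreal) \<Rightarrow> (real^'n \<Rightarrow> (real^'n) functional) set" where
  "Xi_Y_space T Y NY NX = {U \<in> L1loc_dual_Y T Y NY.
     \<exists>w\<in>Xi_space T NX. represents T (\<lambda>\<xi>. of_real (enn2real (NY (U \<xi>)))) w}"

definition X_space ::
    "'n::finite set \<Rightarrow> (real^'n) set \<Rightarrow> ((real^'n) functional \<Rightarrow> ennreal)
       \<Rightarrow> ((real^'n) functional \<Rightarrow> ennreal) \<Rightarrow> ((real^'n) \<times> (real^'n)) functional set" where
  "X_space T Y NY NX = {u \<in> lf_dual (D_prod T Y). \<exists>U\<in>Xi_Y_space T Y NY NX.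
     \<forall>f \<in> lf_space (Cc_dual_prod T Y).
       fourier_dist T Y u f = (\<integral>\<xi>. U \<xi> (\<lambda>y. f (\<xi>, y)) \<partial>dual_haar T)}"

definition A_X_space ::
    "'n::finite set \<Rightarrow> (real^'n) set \<Rightarrow> (real^'n) measure \<Rightarrow> ((real^'n) functional \<Rightarrow> ennreal)
       \<Rightarrow> ((real^'n) functional \<Rightarrow> ennreal) \<Rightarrow> ((real^'n) \<times> (real^'n)) functional set" where
  "A_X_space T Y \<nu> NY NX = X_space T Y NY NX \<inter> Hol_dist T Y \<nu>"

section \<open>The function rho, the distribution u0 and its support\<close>

definition exp_dist :: "(real^'n) set \<Rightarrow> (real^'n) measure \<Rightarrow> real^'n::finite \<Rightarrow> (real^'n) functional" where
  "exp_dist Y \<nu> \<xi> = (\<lambda>h. if h \<in> lf_space (Cc_Y Y)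
     then \<integral>y. of_real (exp (- 2 * pi * (y \<bullet> \<xi>))) * h y \<partial>\<nu> else 0)"

definition rho ::
    "(real^'n) set \<Rightarrow> (real^'n) measure \<Rightarrow> ((real^'n) functional \<Rightarrow> ennreal) \<Rightarrow> real^'n::finite \<Rightarrow> ennreal"
  where "rho Y \<nu> NY \<xi> = NY (exp_dist Y \<nu> \<xi>)"

definition exp_mult ::
    "(real^'n) measure \<Rightarrow> (real^'n) functional \<Rightarrow> ((real^'n) \<times> (real^'n::finite)) functional" where
  "exp_mult \<nu> u0 = (\<lambda>f. \<integral>y. u0 (\<lambda>\<xi>. of_real (exp (- 2 * pi * (y \<bullet> \<xi>))) * f (\<xi>, y)) \<partial>\<nu>)"

definition is_u0 ::
    "'n::finite set \<Rightarrow> (real^'n) set \<Rightarrow> (real^'n) measure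
       \<Rightarrow> ((real^'n) \<times> (real^'n)) functional \<Rightarrow> (real^'n) functional \<Rightarrow> bool" where
  "is_u0 T Y \<nu> u u0 \<longleftrightarrow> u0 \<in> lf_dual (Cc_dual T) \<and>
     (\<forall>f \<in> lf_space (Cc_dual_prod T Y). fourier_dist T Y u f = exp_mult \<nu> u0 f)"

definition dist_support :: "'n::finite set \<Rightarrow> (real^'n) functional \<Rightarrow> (real^'n) set" where
  "dist_support T v = {\<xi> \<in> dual_group T. \<forall>W. open W \<and> \<xi> \<in> W \<longrightarrow>
     (\<exists>f \<in> lf_space (Cc_dual T). closure {\<eta>. f \<eta> \<noteq> 0} \<subseteq> W \<and> v f \<noteq> 0)}"

end

theory Submission
  imports Defs
begin

text \<open>
  Write \<open>\<D>\<close> for the test functions on \<open>Y\<close> and \<open>tilt \<xi> h\<close> for the test function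
  \<open>y \<mapsto> e^(2 \<pi> y\<cdot>\<xi>) h(y)\<close>.  The Fourier transform of \<open>u\<close> has two descriptions:
  it is a field \<open>\<xi> \<mapsto> U \<xi>\<close> of elements of the Banach space, because \<open>u\<close> is in \<open>\<A>\<^sub>X\<close>, and it is the
  product of \<open>u0\<close> with the exponential weight, by the choice of \<open>u0\<close>.  Testing both descriptions against \<open>g(\<xi>) tilt \<xi> h (y)\<close> cancels the
  weight and gives
    \<open>u0(g) \<cdot> \<integral>h d\<nu> = \<integral> g(\<xi>) U \<xi> (tilt \<xi> h) d\<xi>\<close>
  for all test functions \<open>g\<close> and \<open>h\<close>.

  Fix \<open>h0\<close> with nonzero integral; one exists because otherwise every exponential would be the
  zero distribution on \<open>Y\<close>, of norm \<open>0\<close>, whereas \<open>\<rho>\<close> is infinite somewhere.  Then \<open>u0\<close> is the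
  locally integrable function \<open>a(\<xi>) = U \<xi> (tilt \<xi> h0) / \<integral>h0 d\<nu>\<close>, and by the fundamental
  lemma of the calculus of variations (\<open>AE_eq_0_if_integral_test_eq_0\<close>) each \<open>h\<close> satisfies
  \<open>U \<xi> (tilt \<xi> h) = a(\<xi>) \<integral>h d\<nu>\<close> for almost every \<open>\<xi>\<close>.

  The exceptional null set depends on \<open>h\<close>, and there are uncountably many \<open>h\<close>.  It can nevertheless be
  chosen uniformly (\<open>AE_all_test_functions\<close>): the points \<open>(U \<xi>, \<xi>, a \<xi>)\<close> lie in a separable metric
  space, since \<open>U\<close> is a limit of simple functions; a violation of the identity for one \<open>h\<close> is an open condition on
  such points, because \<open>v(tilt \<xi> h)\<close> is jointly continuous in \<open>v\<close> and \<open>\<xi>\<close>; so, as in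
  Lindelof's theorem, countably many null sets cover all violations.  The joint continuity rests on
  \<open>\<bar>v(h)\<bar> \<le> q(h) \<parallel>v\<parallel>\<close> with continuous \<open>q\<close> and on continuity of \<open>\<xi> \<mapsto> tilt \<xi> h\<close> into \<open>\<D>\<close>
  (\<open>continuous_map_tilt\<close>).

  Hence \<open>U \<xi>\<close> is the distribution \<open>a(\<xi>) e^(-2 \<pi> y\<cdot>\<xi>)\<close> for almost every \<open>\<xi>\<close>.  As \<open>U \<xi>\<close> has
  finite norm, \<open>a(\<xi>) \<noteq> 0\<close> forces \<open>\<rho>(\<xi>) < \<infinity>\<close>, so \<open>a\<close> vanishes almost everywhere off the closed set
  \<open>dual_group_nonneg T\<close>, and \<open>u0(g) = 0\<close> whenever the support of \<open>g\<close> avoids that set.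
\<close>

section \<open>A calculus of iterated directional derivatives\<close>

text \<open>Differentiability is demanded at every base point, also off \<open>S\<close>, because the seminorms of the test
  function spaces take suprema over all points; continuity is demanded on \<open>S\<close> only.  Counting the order
  turns closure under products and compositions into plain inductions, in which the derivative is any function with the
  right values instead of a chosen one.\<close>

primrec diff_along ::
    "'a::real_normed_vector set \<Rightarrow> 'a set \<Rightarrow> nat \<Rightarrow> ('a \<Rightarrow> complex) \<Rightarrow> bool" where
  "diff_along B S 0 f \<longleftrightarrow> continuous_on S f"
| "diff_along B S (Suc k) f \<longleftrightarrow> continuous_on S f \<and>
     (\<forall>v\<in>B. \<exists>f'. (\<forall>x. ((\<lambda>t. f (x + t *\<^sub>R v)) has_vector_derivative f' x) (at 0)) \<and>
        diff_along B S k f')"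

lemma diff_along_continuous: "diff_along B S k f \<Longrightarrow> continuous_on S f"
  by (cases k) auto

lemma diff_along_SucE:
  assumes "diff_along B S (Suc k) f" "v \<in> B"
  obtains f' where "\<And>x. ((\<lambda>t. f (x + t *\<^sub>R v)) has_vector_derivative f' x) (at 0)"
    "diff_along B S k f'"
  using assms unfolding diff_along.simps by blast

lemma diff_along_SucI:
  assumes "continuous_on S f"
    and "\<And>v. v \<in> B \<Longrightarrow> \<exists>f'. (\<forall>x. ((\<lambda>t. f (x + t *\<^sub>R v)) has_vector_derivative f' x) (at 0)) \<and>
        diff_along B S k f'"
  shows "diff_along B S (Suc k) f"
  using assms unfolding diff_along.simps by blast

lemma diff_along_SucD: "diff_along B S (Suc k) f \<Longrightarrow> diff_along B S k f"
proof (induction k arbitrary: f)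
  case (Suc k)
  show ?case
    unfolding diff_along.simps(2)[of B S k f]
    using Suc.prems Suc.IH unfolding diff_along.simps(2)[of B S "Suc k" f] by blast
qed simp

lemma diff_along_const [simp]: "diff_along B S k (\<lambda>_. c)"
  by (induction k arbitrary: c)
    (auto intro!: exI[of _ "\<lambda>_. 0"] continuous_intros has_vector_derivative_const)

lemma diff_along_add:
  "diff_along B S k f \<Longrightarrow> diff_along B S k g \<Longrightarrow> diff_along B S k (\<lambda>x. f x + g x)"
proof (induction k arbitrary: f g)
  case (Suc k)
  have "\<exists>d. (\<forall>x. ((\<lambda>t. f (x + t *\<^sub>R v) + g (x + t *\<^sub>R v)) has_vector_derivative d x) (at 0)) \<and>
        diff_along B S k d" if v: "v \<in> B" for v
  proof -
    from Suc.prems v obtain f' g' where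
      f': "\<And>x. ((\<lambda>t. f (x + t *\<^sub>R v)) has_vector_derivative f' x) (at 0)" "diff_along B S k f'" and
      g': "\<And>x. ((\<lambda>t. g (x + t *\<^sub>R v)) has_vector_derivative g' x) (at 0)" "diff_along B S k g'"
      using diff_along_SucE by metis
    show ?thesis
      by (rule exI[of _ "\<lambda>x. f' x + g' x"])
        (auto intro!: has_vector_derivative_add f' g' Suc.IH)
  qed
  then show ?case
    using Suc.prems[THEN diff_along_continuous] by (intro diff_along_SucI continuous_on_add)
qed (auto intro: continuous_on_add)

lemma diff_along_mult:
  "diff_along B S k f \<Longrightarrow> diff_along B S k g \<Longrightarrow> diff_along B S k (\<lambda>x. f x * g x)"
proof (induction k arbitrary: f g)
  case (Suc k)
  have "\<exists>d. (\<forall>x. ((\<lambda>t. f (x + t *\<^sub>R v) * g (x + t *\<^sub>R v)) has_vector_derivative d x) (at 0)) \<and>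
        diff_along B S k d" if v: "v \<in> B" for v
  proof -
    from Suc.prems v obtain f' g' where
      f': "\<And>x. ((\<lambda>t. f (x + t *\<^sub>R v)) has_vector_derivative f' x) (at 0)" "diff_along B S k f'" and
      g': "\<And>x. ((\<lambda>t. g (x + t *\<^sub>R v)) has_vector_derivative g' x) (at 0)" "diff_along B S k g'"
      using diff_along_SucE by metis
    have "((\<lambda>t. f (x + t *\<^sub>R v) * g (x + t *\<^sub>R v)) has_vector_derivative f x * g' x + f' x * g x) (at 0)" for x
      using has_vector_derivative_mult[OF f'(1)[of x] g'(1)[of x]] by simp
    moreover have "diff_along B S k (\<lambda>x. f x * g' x + f' x * g x)"
      using f' g' Suc.prems[THEN diff_along_SucD] by (auto intro!: diff_along_add Suc.IH)
    ultimately show ?thesis by (intro exI[of _ "\<lambda>x. f x * g' x + f' x * g x"]) simp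
  qed
  then show ?case
    using Suc.prems[THEN diff_along_continuous] by (intro diff_along_SucI continuous_on_mult)
qed (auto intro: continuous_on_mult)

lemma diff_along_prod:
  "finite I \<Longrightarrow> (\<And>i. i \<in> I \<Longrightarrow> diff_along B S k (f i)) \<Longrightarrow> diff_along B S k (\<lambda>x. \<Prod>i\<in>I. f i x)"
  by (induction I rule: finite_induct) (auto intro!: diff_along_mult)

text \<open>Pullback along a map that moves each line in a direction of \<open>B'\<close> to a line in a direction of
  \<open>B\<close>, or to a point: this covers projections as well as slices.\<close>

lemma diff_along_compose:
  assumes "continuous_on S' L" "L ` S' \<subseteq> S"
    and L: "\<And>x t v. v \<in> B' \<Longrightarrow> L (x + t *\<^sub>R v) = L x + t *\<^sub>R M v"
    and M: "\<And>v. v \<in> B' \<Longrightarrow> M v = 0 \<or> M v \<in> B"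
  shows "diff_along B S k f \<Longrightarrow> diff_along B' S' k (\<lambda>x. f (L x))"
proof (induction k arbitrary: f)
  case 0
  then show ?case using continuous_on_compose2[OF _ assms(1,2)] by auto
next
  case (Suc k)
  have "\<exists>d. (\<forall>x. ((\<lambda>t. f (L (x + t *\<^sub>R v))) has_vector_derivative d x) (at 0)) \<and>
        diff_along B' S' k d" if v: "v \<in> B'" for v
  proof (cases "M v = 0")
    case True
    then show ?thesis using L[OF v] by (auto intro!: exI[of _ "\<lambda>_. 0"] has_vector_derivative_const)
  next
    case False
    with M v have "M v \<in> B" by blast
    with Suc.prems obtain f' where
      f': "\<And>x. ((\<lambda>t. f (x + t *\<^sub>R M v)) has_vector_derivative f' x) (at 0)" "diff_along B S k f'"
      using diff_along_SucE by metis
    then show ?thesis using Suc.IH[OF f'(2)] L[OF v]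
      by (auto intro!: exI[of _ "\<lambda>x. f' (L x)"])
  qed
  then show ?case
    using Suc.prems[THEN diff_along_continuous] continuous_on_compose2[OF _ assms(1,2)]
    by (intro diff_along_SucI)
qed

lemma diff_along_linear:
  assumes "bounded_linear l"
  shows "diff_along B S k (\<lambda>x. complex_of_real (l x))"
proof -
  interpret bounded_linear l by fact
  have cont: "continuous_on S (\<lambda>x. complex_of_real (l x))"
    by (intro continuous_on_of_real linear_continuous_on assms)
  show ?thesis
  proof (cases k)
    case 0
    with cont show ?thesis by (simp only: diff_along.simps)
  next
    case (Suc n)
    have "((\<lambda>t. complex_of_real (l (x + t *\<^sub>R v))) has_vector_derivative of_real (l v)) (at 0)" for x v
    proof -
      have "((\<lambda>t. of_real (l x) + complex_of_real t * of_real (l v)) has_vector_derivative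
          0 + of_real 1 * of_real (l v)) (at 0)"
        by (intro derivative_intros has_vector_derivative_of_real)
      then show ?thesis by (simp add: add scaleR)
    qed
    then have "\<exists>f'. (\<forall>x. ((\<lambda>t. complex_of_real (l (x + t *\<^sub>R v))) has_vector_derivative f' x) (at 0)) \<and>
        diff_along B S n f'" for v
      by (intro exI[of _ "\<lambda>_. complex_of_real (l v)"]) simp
    then show ?thesis
      unfolding Suc by (intro diff_along_SucI cont)
  qed
qed

text \<open>Off an invariant set of base points a function may be cut off without creating new
  singularities, since the lines of differentiation never cross its boundary.\<close>

lemma diff_along_restrict:
  assumes "\<And>x t v. v \<in> B \<Longrightarrow> x + t *\<^sub>R v \<in> S \<longleftrightarrow> x \<in> S"
  shows "diff_along B UNIV k f \<Longrightarrow> diff_along B S k (\<lambda>x. if x \<in> S then f x else 0)"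
proof (induction k arbitrary: f)
  case 0
  then show ?case
    by (simp, subst continuous_on_cong[of S S _ f]) (auto intro: continuous_on_subset)
next
  case (Suc k)
  have "\<exists>d. (\<forall>x. ((\<lambda>t. if x + t *\<^sub>R v \<in> S then f (x + t *\<^sub>R v) else 0) has_vector_derivative d x) (at 0)) \<and>
        diff_along B S k d" if v: "v \<in> B" for v
  proof -
    from Suc.prems v obtain f' where
      f': "\<And>x. ((\<lambda>t. f (x + t *\<^sub>R v)) has_vector_derivative f' x) (at 0)" "diff_along B UNIV k f'"
      using diff_along_SucE by metis
    show ?thesis
      using f' Suc.IH[OF f'(2)] assms[OF v]
      by (intro exI[of _ "\<lambda>x. if x \<in> S then f' x else 0"]) (auto intro: has_vector_derivative_const)
  qed
  moreover have "continuous_on S (\<lambda>x. if x \<in> S then f x else 0)"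
    using diff_along_continuous[OF Suc.prems]
    by (subst continuous_on_cong[of S S _ f]) (auto intro: continuous_on_subset)
  ultimately show ?case by (intro diff_along_SucI)
qed

lemma iter_deriv_append: "iter_deriv (us @ vs) f = iter_deriv us (iter_deriv vs f)"
  by (induction us) auto

text \<open>The derivative along the last entry of the list is taken first, so the list is consumed from its end.\<close>

lemma diff_along_iter_deriv:
  assumes "vs \<in> lists B" "diff_along B S (length vs + k) f"
  shows "diff_along B S k (iter_deriv vs f)"
  using assms
proof (induction vs arbitrary: f rule: rev_induct)
  case (snoc v vs)
  then have v: "v \<in> B" "vs \<in> lists B" by auto
  from snoc.prems v obtain f' where
    f': "\<And>x. ((\<lambda>t. f (x + t *\<^sub>R v)) has_vector_derivative f' x) (at 0)"
      "diff_along B S (length vs + k) f'"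
    using diff_along_SucE[of B S "length vs + k" f v] by auto
  have "iter_deriv [v] f = f'"
    using f'(1) by (auto simp: vector_derivative_at)
  then show ?case
    using snoc.IH[OF v(2) f'(2)] by (simp add: iter_deriv_append)
qed simp

lemma smooth_along_if_diff_along:
  assumes "\<And>k. diff_along B S k f"
  shows "smooth_along B S f"
  unfolding smooth_along_def
proof (intro ballI conjI)
  fix vs x v assume vs: "vs \<in> lists B" and v: "v \<in> B"
  have "diff_along B S (Suc 0) (iter_deriv vs f)"
    using diff_along_iter_deriv[OF vs assms] .
  then show "(\<lambda>t. iter_deriv vs f (x + t *\<^sub>R v)) differentiable (at 0)"
    using diff_along_SucE[OF _ v] differentiableI_vector by metis
next
  fix vs assume "vs \<in> lists B"
  then show "continuous_on S (iter_deriv vs f)"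
    using diff_along_iter_deriv[OF _ assms] diff_along_continuous by blast
qed

lemma iter_deriv_eq_0_off_invariant:
  assumes inv: "\<And>x t v. v \<in> B \<Longrightarrow> x + t *\<^sub>R v \<in> S \<longleftrightarrow> x \<in> S"
    and f: "\<And>x. x \<notin> S \<Longrightarrow> f x = 0"
  shows "vs \<in> lists B \<Longrightarrow> x \<notin> S \<Longrightarrow> iter_deriv vs f x = (0::complex)"
proof (induction vs arbitrary: x)
  case (Cons v vs)
  then have "(\<lambda>t. iter_deriv vs f (x + t *\<^sub>R v)) = (\<lambda>_. 0)" by (auto simp: inv)
  then show ?case by simp
qed (simp add: f)

text \<open>Off \<open>S\<close> the function vanishes along entire lines in the directions of \<open>B\<close>, which supplies the derivatives at the base points
  that smoothness on \<open>S\<close> does not speak of.\<close>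

lemma diff_along_if_smooth_along:
  assumes inv: "\<And>x t v. v \<in> B \<Longrightarrow> x + t *\<^sub>R v \<in> S \<longleftrightarrow> x \<in> S"
    and f: "\<And>x. x \<notin> S \<Longrightarrow> f x = 0"
    and sm: "smooth_along B S f"
  shows "diff_along B S k f"
proof -
  have "\<forall>vs\<in>lists B. diff_along B S k (iter_deriv vs f)"
  proof (induction k)
    case 0
    then show ?case using sm by (auto simp: smooth_along_def)
  next
    case (Suc k)
    have "((\<lambda>t. iter_deriv vs f (x + t *\<^sub>R v)) has_vector_derivative iter_deriv (v # vs) f x) (at 0)"
      if "vs \<in> lists B" "v \<in> B" for vs v x
    proof (cases "x \<in> S")
      case True
      then show ?thesis using sm that
        by (auto simp: smooth_along_def vector_derivative_works)
    next
      case False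
      then have "(\<lambda>t. iter_deriv vs f (x + t *\<^sub>R v)) = (\<lambda>_. 0)"
        using iter_deriv_eq_0_off_invariant[OF inv f] that by (auto simp: inv)
      then show ?thesis by simp
    qed
    moreover have "v # vs \<in> lists B" if "vs \<in> lists B" "v \<in> B" for vs v using that by auto
    ultimately show ?case
      using Suc sm unfolding diff_along.simps smooth_along_def by meson
  qed
  from this[rule_format, of "[]"] show ?thesis by simp
qed

lemma iter_deriv_eq_0_off_closed:
  assumes K: "closed K" and f: "\<And>x. x \<notin> K \<Longrightarrow> f x = 0"
  shows "x \<notin> K \<Longrightarrow> iter_deriv vs f x = (0::complex)"
proof (induction vs arbitrary: x)
  case (Cons v vs)
  have "((\<lambda>t. x + t *\<^sub>R v) \<longlongrightarrow> x + 0 *\<^sub>R v) (nhds 0)"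
    by (intro tendsto_intros filterlim_ident)
  then have "\<forall>\<^sub>F t in nhds 0. x + t *\<^sub>R v \<in> - K"
    using K Cons.prems by (intro topological_tendstoD) auto
  then have ev: "\<forall>\<^sub>F t in nhds 0. iter_deriv vs f (x + t *\<^sub>R v) = 0"
    by eventually_elim (simp add: Cons.IH)
  have "((\<lambda>t. iter_deriv vs f (x + t *\<^sub>R v)) has_vector_derivative 0) (at 0)"
    using has_vector_derivative_const[of "0::complex" "at (0::real)"] ev
    by (subst has_vector_derivative_cong_ev[where g="\<lambda>_. 0"])
       (auto dest: eventually_nhds_x_imp_x elim: eventually_mono)
  then show ?case by (simp add: vector_derivative_at)
qed (simp add: f)

section \<open>Compactly supported test functions\<close>

text \<open>Only finitely many derivatives of order at most \<open>k\<close> occur, and each is continuous on \<open>K\<close> and zero elsewhere.\<close>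

lemma bdd_above_decay_terms:
  fixes B S K :: "'a::real_normed_vector set"
  assumes B: "finite B" and d: "\<And>k. diff_along B S k f"
    and K: "compact K" "K \<subseteq> S" "\<And>x. x \<notin> K \<Longrightarrow> f x = 0"
  shows "bdd_above (decay_terms B (\<lambda>_. 1) k f)"
proof -
  have fin: "finite {vs. set vs \<subseteq> B \<and> length vs \<le> k}"
    using B by (rule finite_lists_length_le)
  have "bdd_above (range (\<lambda>x. cmod (iter_deriv vs f x)))" if "vs \<in> lists B" for vs
  proof -
    have "continuous_on K (\<lambda>x. cmod (iter_deriv vs f x))"
      using smooth_along_if_diff_along[OF d] that K(2)
      unfolding smooth_along_def
      by (intro continuous_on_norm) (meson continuous_on_subset order_trans)
    then have "bdd_above ((\<lambda>x. cmod (iter_deriv vs f x)) ` K)"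
      using K(1) by (intro bounded_imp_bdd_above compact_imp_bounded compact_continuous_image)
    moreover have "range (\<lambda>x. cmod (iter_deriv vs f x)) \<subseteq> insert 0 ((\<lambda>x. cmod (iter_deriv vs f x)) ` K)"
      using iter_deriv_eq_0_off_closed[of K f, OF compact_imp_closed[OF K(1)] K(3)] by force
    ultimately show ?thesis by (meson bdd_above_insert bdd_above_mono)
  qed
  then have "bdd_above (\<Union>vs\<in>{vs. set vs \<subseteq> B \<and> length vs \<le> k}. range (\<lambda>x. cmod (iter_deriv vs f x)))"
    using fin by (subst bdd_above_UN) (auto simp: in_lists_conv_set subset_iff)
  moreover have "decay_terms B (\<lambda>_. 1) k f \<subseteq>
     (\<Union>vs\<in>{vs. set vs \<subseteq> B \<and> length vs \<le> k}. range (\<lambda>x. cmod (iter_deriv vs f x)))"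
    by (auto simp: decay_terms_def)
  ultimately show ?thesis by (rule bdd_above_mono)
qed

text \<open>For compact supports the decay conditions are automatic, so a test function is a smooth function that vanishes
  off a compact set.\<close>

lemma mem_lf_space_test_lf_iff:
  fixes B S L :: "'a::real_normed_vector set"
  assumes B: "finite B" and inv: "\<And>x t v. v \<in> B \<Longrightarrow> x + t *\<^sub>R v \<in> S \<longleftrightarrow> x \<in> S" and L: "L \<subseteq> S"
  shows "f \<in> lf_space (test_lf UNIV S B (\<lambda>_. 1) {K. compact K \<and> K \<subseteq> L}) \<longleftrightarrow>
    (\<forall>k. diff_along B S k f) \<and> (\<exists>K. compact K \<and> K \<subseteq> L \<and> (\<forall>x. x \<notin> K \<longrightarrow> f x = 0))"
    (is "?l \<longleftrightarrow> ?r")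
proof
  assume ?l
  then obtain K where K: "compact K" "K \<subseteq> L" "\<forall>x. x \<notin> K \<longrightarrow> f x = 0" "smooth_along B S f"
    by (auto simp: lf_space_def test_lf_def)
  then have "diff_along B S k f" for k
    using L by (intro diff_along_if_smooth_along inv) auto
  with K show ?r by blast
next
  assume ?r
  then obtain K where d: "\<And>k. diff_along B S k f"
    and K: "compact K" "K \<subseteq> L" "\<And>x. x \<notin> K \<Longrightarrow> f x = 0" by blast
  have "bdd_above (decay_terms B (\<lambda>_. 1) k f)" for k
    using K(2) L by (intro bdd_above_decay_terms[OF B d K(1) _ K(3)]) auto
  with K show ?l
    using smooth_along_if_diff_along[OF d] by (auto simp: lf_space_def test_lf_def)
qed

lemma dual_group_invariant:
  "v \<in> dual_dirs T \<Longrightarrow> x + t *\<^sub>R v \<in> dual_group T \<longleftrightarrow> x \<in> dual_group T"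
proof -
  assume "v \<in> dual_dirs T"
  then have "(x + t *\<^sub>R v) $ i = x $ i" if "i \<in> T" for i
    using that by (auto simp: dual_dirs_def axis_def split: if_splits)
  then show ?thesis unfolding dual_group_def by (simp del: vector_add_component vector_scaleR_component)
qed

lemma finite_dual_dirs: "finite (dual_dirs T)"
  by (auto simp: dual_dirs_def)

lemma mem_Cc_Y_iff:
  "h \<in> lf_space (Cc_Y Y) \<longleftrightarrow> (\<forall>k. diff_along Basis UNIV k h) \<and>
     (\<exists>K. compact K \<and> K \<subseteq> Y \<and> (\<forall>y. y \<notin> K \<longrightarrow> h y = 0))"
  unfolding Cc_Y_def by (rule mem_lf_space_test_lf_iff) auto

lemma mem_Cc_dual_iff:
  "g \<in> lf_space (Cc_dual T) \<longleftrightarrow> (\<forall>k. diff_along (dual_dirs T) (dual_group T) k g) \<and>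
     (\<exists>K. compact K \<and> K \<subseteq> dual_group T \<and> (\<forall>\<xi>. \<xi> \<notin> K \<longrightarrow> g \<xi> = 0))"
  unfolding Cc_dual_def
  by (rule mem_lf_space_test_lf_iff) (auto simp: finite_dual_dirs dual_group_invariant)

lemma mem_Cc_dual_prod_iff:
  "f \<in> lf_space (Cc_dual_prod T Y) \<longleftrightarrow>
     (\<forall>k. diff_along (dual_prod_dirs T) (dual_group T \<times> UNIV) k f) \<and>
     (\<exists>K. compact K \<and> K \<subseteq> dual_group T \<times> Y \<and> (\<forall>p. p \<notin> K \<longrightarrow> f p = 0))"
  unfolding Cc_dual_prod_def
  by (rule mem_lf_space_test_lf_iff)
     (auto simp: finite_dual_dirs dual_group_invariant dual_prod_dirs_def)

section \<open>Exponential tilts of test functions\<close>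

text \<open>The factor is inverse to the weight \<open>e^(-2 \<pi> y\<cdot>\<xi>)\<close> that relates the Fourier transform of a holomorphic
  function to \<open>u0\<close>.\<close>

definition tilt :: "real^'n \<Rightarrow> (real^'n \<Rightarrow> complex) \<Rightarrow> real^'n::finite \<Rightarrow> complex" where
  "tilt \<xi> h = (\<lambda>y. of_real (exp (2 * pi * (y \<bullet> \<xi>))) * h y)"

lemma tilt_uminus_cancel: "tilt \<xi> (tilt (- \<xi>) h) = h"
  by (simp add: tilt_def mult.assoc[symmetric] flip: of_real_mult exp_add)

lemma diff_along_exp_inner:
  "diff_along B S k (\<lambda>p::'a::real_inner \<times> 'a. complex_of_real (exp (c * (snd p \<bullet> fst p))))"
proof (induction k)
  case (Suc k)
  let ?E = "\<lambda>p::'a \<times> 'a. complex_of_real (exp (c * (snd p \<bullet> fst p)))"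
  show ?case
  proof (rule diff_along_SucI)
    fix v :: "'a \<times> 'a"
    let ?l = "\<lambda>p::'a \<times> 'a. c * (snd v \<bullet> fst p + snd p \<bullet> fst v)"
    have "bounded_linear ?l"
      by (intro bounded_linear_const_mult bounded_linear_add bounded_linear_inner_left_comp
            bounded_linear_inner_right_comp bounded_linear_fst bounded_linear_snd)
    then have "diff_along B S k (\<lambda>p. of_real (?l p) * ?E p)"
      by (intro diff_along_mult diff_along_linear Suc)
    moreover have "((\<lambda>t. ?E (p + t *\<^sub>R v)) has_vector_derivative of_real (?l p) * ?E p) (at 0)" for p
    proof -
      have "((\<lambda>t. c * ((snd p + t *\<^sub>R snd v) \<bullet> (fst p + t *\<^sub>R fst v))) has_real_derivative ?l p) (at 0)"
        by (auto intro!: derivative_eq_intros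
             simp: inner_add_left inner_add_right inner_commute algebra_simps)
      from has_vector_derivative_of_real[OF DERIV_fun_exp[OF this]] show ?thesis
        by (simp add: mult.commute)
    qed
    ultimately show "\<exists>f'. (\<forall>p. ((\<lambda>t. ?E (p + t *\<^sub>R v)) has_vector_derivative f' p) (at 0)) \<and>
        diff_along B S k f'" by (intro exI[of _ "\<lambda>p. of_real (?l p) * ?E p"]) blast
  qed (use Suc diff_along_continuous in blast)
qed (auto intro!: continuous_intros)

text \<open>Joint smoothness in \<open>(\<xi>, y)\<close> serves two purposes: it yields test functions on the product, and
  it makes the derivatives in \<open>y\<close> depend continuously on \<open>\<xi>\<close>.\<close>

lemma diff_along_tilt_joint:
  fixes h :: "real^'n::finite \<Rightarrow> complex"
  assumes "\<And>k. diff_along Basis UNIV k h" and B: "snd ` B \<subseteq> insert 0 Basis"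
  shows "diff_along B S k (\<lambda>p. tilt (fst p) h (snd p))"
proof -
  have "diff_along B S k (\<lambda>p. h (snd p))"
    using B by (intro diff_along_compose[where L=snd and M=snd, OF _ _ _ _ assms(1)])
      (auto intro!: continuous_intros)
  then show ?thesis
    unfolding tilt_def by (intro diff_along_mult diff_along_exp_inner)
qed

lemma diff_along_tilt:
  fixes h :: "real^'n::finite \<Rightarrow> complex"
  assumes "\<And>k. diff_along Basis UNIV k h"
  shows "diff_along Basis UNIV k (tilt \<xi> h)"
proof -
  have "diff_along (Pair 0 ` Basis) UNIV k (\<lambda>p::(real^'n) \<times> (real^'n). tilt (fst p) h (snd p))"
    by (intro diff_along_tilt_joint assms) auto
  then have "diff_along Basis UNIV k (\<lambda>y. tilt (fst (\<xi>, y)) h (snd (\<xi>, y)))"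
    by (rule diff_along_compose[where L="Pair \<xi>" and M="Pair 0", rotated -1])
       (auto intro!: continuous_intros)
  then show ?thesis by simp
qed

lemma tilt_mem_Cc_Y:
  assumes "h \<in> lf_space (Cc_Y Y)"
  shows "tilt \<xi> h \<in> lf_space (Cc_Y Y)"
proof -
  from assms obtain K where d: "\<And>k. diff_along Basis UNIV k h"
    and "compact K" "K \<subseteq> Y" "\<forall>y. y \<notin> K \<longrightarrow> h y = 0" unfolding mem_Cc_Y_iff by blast
  then have "compact K \<and> K \<subseteq> Y \<and> (\<forall>y. y \<notin> K \<longrightarrow> tilt \<xi> h y = 0)" by (simp add: tilt_def)
  with diff_along_tilt[OF d] show ?thesis unfolding mem_Cc_Y_iff by blast
qed

lemma Cc_Y_add:
  assumes "f \<in> lf_space (Cc_Y Y)" "g \<in> lf_space (Cc_Y Y)"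
  shows "(\<lambda>y. f y + g y) \<in> lf_space (Cc_Y Y)"
proof -
  from assms obtain K L where "compact K" "K \<subseteq> Y" "\<forall>y. y \<notin> K \<longrightarrow> f y = 0"
    "compact L" "L \<subseteq> Y" "\<forall>y. y \<notin> L \<longrightarrow> g y = 0" unfolding mem_Cc_Y_iff by blast
  then have "compact (K \<union> L) \<and> K \<union> L \<subseteq> Y \<and> (\<forall>y. y \<notin> K \<union> L \<longrightarrow> f y + g y = 0)"
    by auto
  then show ?thesis
    using assms unfolding mem_Cc_Y_iff by (blast intro: diff_along_add)
qed

lemma Cc_Y_scale:
  assumes "f \<in> lf_space (Cc_Y Y)"
  shows "(\<lambda>y. c * f y) \<in> lf_space (Cc_Y Y)"
proof -
  from assms obtain K where d: "\<And>k. diff_along Basis UNIV k f"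
    and "compact K" "K \<subseteq> Y" "\<forall>y. y \<notin> K \<longrightarrow> f y = 0" unfolding mem_Cc_Y_iff by blast
  then have "compact K \<and> K \<subseteq> Y \<and> (\<forall>y. y \<notin> K \<longrightarrow> c * f y = 0)" by simp
  with diff_along_mult[OF diff_along_const d] show ?thesis unfolding mem_Cc_Y_iff by blast
qed

lemma Cc_Y_diff:
  assumes "f \<in> lf_space (Cc_Y Y)" "g \<in> lf_space (Cc_Y Y)"
  shows "(\<lambda>y. f y - g y) \<in> lf_space (Cc_Y Y)"
  using Cc_Y_add[OF assms(1) Cc_Y_scale[OF assms(2), of "- 1"]] by simp

lemma tilt_tensor_mem_Cc_dual_prod:
  assumes g: "g \<in> lf_space (Cc_dual T)" and h: "h \<in> lf_space (Cc_Y Y)"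
  shows "(\<lambda>(\<xi>, y). g \<xi> * tilt \<xi> h y) \<in> lf_space (Cc_dual_prod T Y)"
proof -
  from g obtain K where g': "\<And>k. diff_along (dual_dirs T) (dual_group T) k g"
    and K: "compact K" "K \<subseteq> dual_group T" "\<forall>\<xi>. \<xi> \<notin> K \<longrightarrow> g \<xi> = 0"
    unfolding mem_Cc_dual_iff by blast
  from h obtain L where h': "\<And>k. diff_along Basis UNIV k h"
    and L: "compact L" "L \<subseteq> Y" "\<forall>y. y \<notin> L \<longrightarrow> h y = 0"
    unfolding mem_Cc_Y_iff by blast
  have "diff_along (dual_prod_dirs T) (dual_group T \<times> UNIV) k (\<lambda>p. g (fst p) * tilt (fst p) h (snd p))" for k
  proof (intro diff_along_mult diff_along_tilt_joint h')
    show "diff_along (dual_prod_dirs T) (dual_group T \<times> UNIV) k (\<lambda>p. g (fst p))"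
      by (intro diff_along_compose[where L=fst and M=fst, OF _ _ _ _ g'])
        (auto intro!: continuous_intros simp: dual_prod_dirs_def)
  qed (auto simp: dual_prod_dirs_def)
  moreover have "compact (K \<times> L)" "K \<times> L \<subseteq> dual_group T \<times> Y"
    "\<forall>p. p \<notin> K \<times> L \<longrightarrow> g (fst p) * tilt (fst p) h (snd p) = 0"
    using K L by (auto simp: compact_Times tilt_def)
  ultimately show ?thesis
    unfolding mem_Cc_dual_prod_iff case_prod_beta by blast
qed

lemma iter_deriv_slice:
  "iter_deriv (map (Pair 0) vs) F (\<xi>, y) = iter_deriv vs (\<lambda>y. F (\<xi>, y)) y"
  by (induction vs arbitrary: y) simp_all

text \<open>The difference is a slice of one smooth function of \<open>(\<xi>, y)\<close> that vanishes for \<open>\<xi> = \<xi>0\<close>; its derivatives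
  are uniformly continuous on a compact neighbourhood of \<open>{\<xi>0} \<times> K\<close>.\<close>

lemma eventually_iter_deriv_tilt_small:
  fixes h :: "real^'n::finite \<Rightarrow> complex"
  assumes h: "\<And>k. diff_along Basis UNIV k h" and K: "compact K" "\<And>y. y \<notin> K \<Longrightarrow> h y = 0"
    and vs: "vs \<in> lists Basis" and e: "0 < e"
  shows "\<forall>\<^sub>F \<xi> in nhds \<xi>0. \<forall>y. cmod (iter_deriv vs (\<lambda>y. tilt \<xi> h y - tilt \<xi>0 h y) y) \<le> e"
proof -
  define F where "F = (\<lambda>p. tilt (fst p) h (snd p) + (- 1) * tilt \<xi>0 h (snd p))"
  define G where "G = iter_deriv (map (Pair 0) vs) F"
  have dF: "diff_along (Pair 0 ` Basis) UNIV k F" for k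
    unfolding F_def
    by (intro diff_along_add diff_along_mult diff_along_const diff_along_tilt_joint h
         diff_along_compose[where L=snd and M=snd, OF _ _ _ _ diff_along_tilt[OF h]])
       (auto intro!: continuous_intros)
  have "map (Pair 0) vs \<in> lists (Pair 0 ` (Basis :: (real^'n) set))"
    using vs by auto
  with smooth_along_if_diff_along[OF dF]
  have "continuous_on UNIV G" unfolding smooth_along_def G_def by blast
  then have "uniformly_continuous_on (cball \<xi>0 1 \<times> K) G"
    by (intro compact_uniformly_continuous compact_Times compact_cball K(1))
      (rule continuous_on_subset, auto)
  then obtain d where d: "d > 0" "\<And>p p'. p \<in> cball \<xi>0 1 \<times> K \<Longrightarrow> p' \<in> cball \<xi>0 1 \<times> K \<Longrightarrow>
      dist p' p < d \<Longrightarrow> dist (G p') (G p) < e"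
    using e unfolding uniformly_continuous_on_def by metis
  have G: "G (\<xi>, y) = iter_deriv vs (\<lambda>y. tilt \<xi> h y - tilt \<xi>0 h y) y" for \<xi> y
    by (simp add: G_def iter_deriv_slice F_def)
  have G0: "G (\<xi>0, y) = 0" for y
    unfolding G by (simp add: iter_deriv_eq_0_off_closed[of "{}"])
  have "\<forall>\<^sub>F \<xi> in nhds \<xi>0. dist \<xi> \<xi>0 < min 1 d"
    unfolding eventually_nhds_metric using d(1) by (intro exI[of _ "min 1 d"]) auto
  then show ?thesis
  proof eventually_elim
    case (elim \<xi>)
    have "cmod (G (\<xi>, y)) \<le> e" for y
    proof (cases "y \<in> K")
      case True
      with elim have "dist (G (\<xi>, y)) (G (\<xi>0, y)) < e"
        by (intro d(2)) (auto simp: dist_commute dist_prod_def)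
      then show ?thesis by (simp add: G0)
    next
      case False
      have "iter_deriv vs (\<lambda>y. tilt \<xi> h y - tilt \<xi>0 h y) y = 0"
        using False K
        by (intro iter_deriv_eq_0_off_closed[of K]) (auto simp: tilt_def compact_imp_closed)
      then show ?thesis using e by (simp add: G)
    qed
    then show ?case by (simp add: G)
  qed
qed

lemma lf_seminorm_triangle:
  "p \<in> lf_seminorms F \<Longrightarrow> f \<in> lf_space F \<Longrightarrow> g \<in> lf_space F \<Longrightarrow> p (\<lambda>x. f x + g x) \<le> p f + p g"
  by (simp add: lf_seminorms_def)

lemma lf_seminorm_step_bound:
  "p \<in> lf_seminorms F \<Longrightarrow> E \<in> fst F \<Longrightarrow> \<exists>C k. \<forall>f\<in>E. p f \<le> C * snd F k f"
  by (simp add: lf_seminorms_def)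

lemma eventually_seminorm_tilt_small:
  fixes h :: "real^'n::finite \<Rightarrow> complex"
  assumes h: "h \<in> lf_space (Cc_Y Y)" and p: "p \<in> lf_seminorms (Cc_Y Y)" and e: "0 < e"
  shows "\<forall>\<^sub>F \<xi> in nhds \<xi>0. p (\<lambda>y. tilt \<xi> h y - tilt \<xi>0 h y) < e"
proof -
  from h obtain K where h': "\<And>k. diff_along Basis UNIV k h"
    and K: "compact K" "K \<subseteq> Y" "\<And>y. y \<notin> K \<Longrightarrow> h y = 0"
    unfolding mem_Cc_Y_iff by blast
  define E where "E = {f::real^'n \<Rightarrow> complex. f \<in> UNIV \<and> smooth_along Basis UNIV f \<and> (\<forall>x. x \<notin> K \<longrightarrow> f x = 0) \<and>
                (\<forall>k. bdd_above (decay_terms Basis (\<lambda>_. 1) k f))}"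
  have "E \<in> fst (Cc_Y Y)"
    using K by (auto simp: Cc_Y_def test_lf_def E_def)
  from lf_seminorm_step_bound[OF p this]
  obtain C k where Ck: "\<And>f. f \<in> E \<Longrightarrow> p f \<le> C * snd (Cc_Y Y) k f" by blast
  \<comment> \<open>The constant \<open>C\<close> of a continuous seminorm may be zero or negative.\<close>
  define \<delta> where "\<delta> = e / (\<bar>C\<bar> + 1)"
  have \<delta>: "\<delta> > 0" using e by (simp add: \<delta>_def)
  have "\<bar>C\<bar> * \<delta> = e * (\<bar>C\<bar> / (\<bar>C\<bar> + 1))" by (simp add: \<delta>_def)
  also have "\<dots> < e * 1" using e by (intro mult_strict_left_mono) auto
  finally have C\<delta>: "\<bar>C\<bar> * \<delta> < e" by simp
  have "\<forall>\<^sub>F \<xi> in nhds \<xi>0. \<forall>vs\<in>{vs. set vs \<subseteq> Basis \<and> length vs \<le> k}.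
      \<forall>y. cmod (iter_deriv vs (\<lambda>y. tilt \<xi> h y - tilt \<xi>0 h y) y) \<le> \<delta>"
    by (intro eventually_ball_finite finite_lists_length_le ballI
        eventually_iter_deriv_tilt_small[OF h' K(1,3) _ \<delta>]) auto
  then show ?thesis
  proof eventually_elim
    case (elim \<xi>)
    let ?f = "\<lambda>y. tilt \<xi> h y - tilt \<xi>0 h y" and ?D = "decay_terms Basis (\<lambda>_. 1) k"
    have d: "diff_along Basis UNIV k ?f" for k
      using diff_along_add[OF diff_along_tilt[OF h'] diff_along_mult[OF diff_along_const diff_along_tilt[OF h']],
          of k \<xi> "-1" \<xi>0] by simp
    have f0: "?f y = 0" if "y \<notin> K" for y using K(3)[OF that] by (simp add: tilt_def)
    have bdd: "bdd_above (decay_terms Basis (\<lambda>_. 1) k ?f)" for k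
      by (rule bdd_above_decay_terms[OF _ d K(1) _ f0]) auto
    have "?f \<in> E"
      using smooth_along_if_diff_along[OF d] bdd f0 by (simp add: E_def)
    then have "p ?f \<le> C * Sup (?D ?f)"
      using Ck by (auto simp: Cc_Y_def test_lf_def)
    also have "\<dots> \<le> \<bar>C\<bar> * \<bar>Sup (?D ?f)\<bar>" by (metis abs_ge_self abs_mult)
    also have "\<bar>Sup (?D ?f)\<bar> \<le> \<delta>"
    proof -
      have mem: "cmod (?f 0) \<in> ?D ?f"
        unfolding decay_terms_def by (rule CollectI, intro exI[of _ 0] exI[of _ "[]"]) auto
      have "0 \<le> Sup (?D ?f)"
        by (rule cSup_upper2[OF mem _ bdd]) simp
      moreover have "Sup (?D ?f) \<le> \<delta>"
        using mem elim by (intro cSup_least) (auto simp: decay_terms_def subset_iff)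
      ultimately show ?thesis by simp
    qed
    finally have "p ?f \<le> \<bar>C\<bar> * \<delta>" by (simp add: mult_left_mono)
    with C\<delta> show ?case by simp
  qed
qed

text \<open>A tilt does not enlarge the support, so all tilts of \<open>h\<close> stay in one step of the inductive limit, where convergence is
  uniform convergence of all derivatives.\<close>

lemma continuous_map_tilt:
  assumes h: "h \<in> lf_space (Cc_Y Y)"
  shows "continuous_map euclidean (lf_topology (Cc_Y Y)) (\<lambda>\<xi>. tilt \<xi> h)"
  unfolding lf_topology_def continuous_on_generated_topo_iff
proof (intro conjI allI impI)
  fix U assume "U \<in> {{g \<in> lf_space (Cc_Y Y). p (\<lambda>x. g x - f x) < e} | p f e.
        p \<in> lf_seminorms (Cc_Y Y) \<and> f \<in> lf_space (Cc_Y Y) \<and> 0 < e}"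
  then obtain p f e where U: "U = {g \<in> lf_space (Cc_Y Y). p (\<lambda>x. g x - f x) < e}"
    and p: "p \<in> lf_seminorms (Cc_Y Y)" and f: "f \<in> lf_space (Cc_Y Y)" by blast
  have tri: "p (\<lambda>x. tilt \<xi> h x - f x) \<le> p (\<lambda>x. tilt \<xi> h x - tilt \<xi>0 h x) + p (\<lambda>x. tilt \<xi>0 h x - f x)" for \<xi> \<xi>0
  proof -
    have "p (\<lambda>x. (tilt \<xi> h x - tilt \<xi>0 h x) + (tilt \<xi>0 h x - f x)) \<le>
        p (\<lambda>x. tilt \<xi> h x - tilt \<xi>0 h x) + p (\<lambda>x. tilt \<xi>0 h x - f x)"
      by (intro lf_seminorm_triangle[OF p] Cc_Y_diff tilt_mem_Cc_Y h f)
    then show ?thesis by simp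
  qed
  have "open ((\<lambda>\<xi>. tilt \<xi> h) -` U)"
  proof (subst open_subopen, intro ballI)
    fix \<xi>0 assume "\<xi>0 \<in> (\<lambda>\<xi>. tilt \<xi> h) -` U"
    then have less: "0 < e - p (\<lambda>x. tilt \<xi>0 h x - f x)" by (simp add: U)
    have "\<forall>\<^sub>F \<xi> in nhds \<xi>0. \<xi> \<in> (\<lambda>\<xi>. tilt \<xi> h) -` U"
      using eventually_seminorm_tilt_small[OF h p less]
    proof eventually_elim
      case (elim \<xi>)
      then show ?case using tri[of \<xi> \<xi>0] tilt_mem_Cc_Y[OF h] by (simp add: U)
    qed
    then show "\<exists>V. open V \<and> \<xi>0 \<in> V \<and> V \<subseteq> (\<lambda>\<xi>. tilt \<xi> h) -` U"
      unfolding eventually_nhds by blast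
  qed
  then show "openin euclidean ((\<lambda>\<xi>. tilt \<xi> h) -` U \<inter> topspace euclidean)"
    by simp
next
  have "(\<lambda>_. 0) \<in> lf_seminorms (Cc_Y Y)"
    unfolding lf_seminorms_def by (auto intro!: exI[of _ 0])
  then show "(\<lambda>\<xi>. tilt \<xi> h) ` topspace euclidean \<subseteq>
     \<Union> {{g \<in> lf_space (Cc_Y Y). p (\<lambda>x. g x - f x) < e} | p f e.
        p \<in> lf_seminorms (Cc_Y Y) \<and> f \<in> lf_space (Cc_Y Y) \<and> 0 < e}"
    using tilt_mem_Cc_Y[OF h] by (force intro: exI[of _ "1::real"])
qed

section \<open>Smooth approximations of boxes\<close>

text \<open>The flat functions \<open>t^(-m) e^(-1/t)\<close>, extended by 0: the powers of \<open>1/t\<close> make the family closed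
  under differentiation up to linear combinations.\<close>

definition flat_fun :: "nat \<Rightarrow> real \<Rightarrow> real" where
  "flat_fun m t = (if 0 < t then inverse t ^ m * exp (- inverse t) else 0)"

lemma flat_fun_tendsto_0: "(flat_fun m \<longlongrightarrow> 0) (at 0)"
proof (rule filterlim_split_at)
  have "((\<lambda>_. 0) \<longlongrightarrow> (0::real)) (at_left 0)" by simp
  then show "(flat_fun m \<longlongrightarrow> 0) (at_left 0)"
    by (rule Lim_transform_eventually)
       (auto simp: flat_fun_def eventually_at_filter intro!: always_eventually)
  have "((\<lambda>t. inverse t ^ m / exp (inverse t)) \<longlongrightarrow> (0::real)) (at_right 0)"
    by (rule filterlim_compose[OF tendsto_power_div_exp_0 filterlim_inverse_at_top_right])
  then show "(flat_fun m \<longlongrightarrow> 0) (at_right 0)"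
    by (rule Lim_transform_eventually)
       (auto simp: flat_fun_def eventually_at_filter exp_minus divide_inverse intro!: always_eventually)
qed

text \<open>At \<open>0\<close> the difference quotient of \<open>flat_fun m\<close> is \<open>flat_fun (m + 1)\<close> itself, so smoothness there
  reduces to the limit of that function.\<close>

lemma flat_fun_has_derivative:
  "(flat_fun m has_real_derivative flat_fun (m + 2) t - real m * flat_fun (m + 1) t) (at t)"
proof -
  consider "t < 0" | "t = 0" | "0 < t" by linarith
  then show ?thesis
  proof cases
    case 1
    have "((\<lambda>_. 0) has_real_derivative 0) (at t)" by simp
    then have "(flat_fun m has_real_derivative 0) (at t)"
      by (rule has_field_derivative_transform_within_open[of _ _ _ "{..<0}"])
         (use 1 in \<open>auto simp: flat_fun_def\<close>)
    with 1 show ?thesis by (simp add: flat_fun_def)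
  next
    case 2
    have "(\<lambda>h. (flat_fun m (0 + h) - flat_fun m 0) / h) = flat_fun (m + 1)"
      by (auto simp: flat_fun_def divide_inverse)
    then show ?thesis
      using flat_fun_tendsto_0[of "m + 1"] 2 by (simp add: DERIV_def) (simp add: flat_fun_def)
  next
    case 3
    have "((\<lambda>u. u ^ m * exp (- u)) has_real_derivative
        (real m * u ^ (m - 1) - u ^ m) * exp (- u)) (at u)" for u :: real
      by (auto intro!: derivative_eq_intros simp: left_diff_distrib)
    from DERIV_chain2[OF this DERIV_inverse, of t]
    have "((\<lambda>t. inverse t ^ m * exp (- inverse t)) has_real_derivative
        (real m * inverse t ^ (m - 1) - inverse t ^ m) * exp (- inverse t) * - (inverse t ^ 2)) (at t)"
      using 3 by (simp add: numeral_2_eq_2)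
    also have "(real m * inverse t ^ (m - 1) - inverse t ^ m) * exp (- inverse t) * - (inverse t ^ 2) =
        flat_fun (m + 2) t - real m * flat_fun (m + 1) t"
      using 3 by (cases m) (simp_all add: flat_fun_def power2_eq_square left_diff_distrib)
    finally have "((\<lambda>t. inverse t ^ m * exp (- inverse t)) has_real_derivative
        flat_fun (m + 2) t - real m * flat_fun (m + 1) t) (at t)" .
    then show ?thesis
      by (rule has_field_derivative_transform_within_open[of _ _ _ "{0<..}"])
         (use 3 in \<open>auto simp: flat_fun_def\<close>)
  qed
qed

lemma diff_along_flat_fun:
  assumes l: "bounded_linear l"
  shows "diff_along B S k (\<lambda>x. complex_of_real (flat_fun m (l x + c)))"
proof (induction k arbitrary: m)
  case 0
  have "continuous_on UNIV (flat_fun m)"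
    using flat_fun_has_derivative by (auto intro!: DERIV_isCont continuous_at_imp_continuous_on)
  then have "continuous_on S (\<lambda>x. flat_fun m (l x + c))"
    by (rule continuous_on_compose2)
       (intro continuous_on_add linear_continuous_on l continuous_on_const subset_UNIV)+
  then show ?case by (auto intro!: continuous_intros)
next
  case (Suc k)
  interpret bounded_linear l by fact
  show ?case
  proof (rule diff_along_SucI)
    show "continuous_on S (\<lambda>x. complex_of_real (flat_fun m (l x + c)))"
      by (rule diff_along_continuous[OF Suc])
    fix v
    let ?f' = "\<lambda>x. complex_of_real (l v) * (of_real (flat_fun (m + 2) (l x + c))
        + of_real (- real m) * of_real (flat_fun (m + 1) (l x + c)))"
    have "((\<lambda>t. complex_of_real (flat_fun m (l (x + t *\<^sub>R v) + c))) has_vector_derivative ?f' x) (at 0)" for x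
    proof -
      have d: "((\<lambda>t. l (x + t *\<^sub>R v) + c) has_real_derivative l v) (at 0)"
        by (auto simp: add scaleR intro!: derivative_eq_intros)
      have "((\<lambda>t. flat_fun m (l (x + t *\<^sub>R v) + c)) has_real_derivative
          (flat_fun (m + 2) (l x + c) - real m * flat_fun (m + 1) (l x + c)) * l v) (at 0)"
        using DERIV_chain2[OF flat_fun_has_derivative d] by simp
      from has_vector_derivative_of_real[OF this] show ?thesis
        by (simp add: algebra_simps)
    qed
    moreover have "diff_along B S k ?f'"
      by (intro diff_along_mult diff_along_add diff_along_const Suc)
    ultimately show "\<exists>f'. (\<forall>x. ((\<lambda>t. complex_of_real (flat_fun m (l (x + t *\<^sub>R v) + c)))
        has_vector_derivative f' x) (at 0)) \<and> diff_along B S k f'"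
      by (intro exI[of _ ?f']) simp
  qed
qed

text \<open>Scaling the argument by \<open>n\<close> sharpens \<open>e^(-1/t)\<close> to the indicator function of \<open>t > 0\<close>.  The sums are written
  as linear form plus constant, the shape of \<open>diff_along_flat_fun\<close>.\<close>

definition box_bump :: "nat \<Rightarrow> real^'n \<Rightarrow> real^'n \<Rightarrow> real^'n::finite \<Rightarrow> complex" where
  "box_bump n a b x = (\<Prod>i\<in>UNIV. of_real (flat_fun 0 (real n * x $ i + - real n * a $ i)) *
     of_real (flat_fun 0 (- real n * x $ i + real n * b $ i)))"

lemma diff_along_box_bump: "diff_along B S k (box_bump n a b)"
proof -
  have "bounded_linear (\<lambda>x::real^'n. c * x $ i)" for c i
    by (intro bounded_linear_const_mult bounded_linear_vec_nth)
  then have "diff_along B S k (\<lambda>x. \<Prod>i\<in>UNIV. complex_of_real (flat_fun 0 (real n * x $ i + - real n * a $ i)) *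
     of_real (flat_fun 0 (- real n * x $ i + real n * b $ i)))"
    by (intro diff_along_prod diff_along_mult diff_along_flat_fun finite)
  then show ?thesis by (simp only: box_bump_def[abs_def])
qed

lemma flat_fun_0_bounds: "0 \<le> flat_fun 0 t" "flat_fun 0 t \<le> 1"
  by (auto simp: flat_fun_def)

lemma norm_box_bump_le: "cmod (box_bump n a b x) \<le> indicator (box a b) x"
proof (cases "x \<in> box a b")
  case True
  have "cmod (box_bump n a b x) \<le> 1"
    unfolding box_bump_def prod_norm[symmetric] norm_mult norm_of_real
    by (intro prod_le_1) (auto intro!: mult_le_one simp: flat_fun_0_bounds abs_of_nonneg)
  with True show ?thesis by simp
next
  case False
  then obtain i where "\<not> (a $ i < x $ i \<and> x $ i < b $ i)" by (auto simp: mem_box_cart)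
  then have "real n * x $ i \<le> real n * a $ i \<or> real n * b $ i \<le> real n * x $ i"
    by (auto simp: not_less intro: mult_left_mono)
  then have "flat_fun 0 (real n * x $ i + - real n * a $ i) * flat_fun 0 (- real n * x $ i + real n * b $ i) = 0"
    by (auto simp: flat_fun_def)
  then have "box_bump n a b x = 0"
    unfolding box_bump_def by (intro prod_zero) (auto intro!: exI[of _ i])
  then show ?thesis by simp
qed

lemma flat_fun_scaled_tendsto_1:
  assumes "0 < s" shows "(\<lambda>n. flat_fun 0 (real n * s)) \<longlonglongrightarrow> 1"
proof -
  have "(\<lambda>n. exp (- (inverse s * inverse (real n)))) \<longlonglongrightarrow> exp (- (inverse s * 0))"
    by (intro tendsto_intros lim_inverse_n)
  then show ?thesis
    by (rule_tac Lim_transform_eventually)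
       (use assms in \<open>auto simp: flat_fun_def eventually_sequentially intro!: exI[of _ 1]\<close>)
qed

lemma box_bump_tendsto:
  fixes x :: "real^'n::finite"
  shows "(\<lambda>n. box_bump n a b x) \<longlonglongrightarrow> indicator (box a b) x"
proof (cases "x \<in> box a b")
  case True
  have lim: "(\<lambda>n. complex_of_real (flat_fun 0 (real n * x $ i + - real n * a $ i)) *
      of_real (flat_fun 0 (- real n * x $ i + real n * b $ i))) \<longlonglongrightarrow> of_real 1 * of_real 1" for i
  proof (intro tendsto_mult tendsto_of_real)
    have "0 < x $ i - a $ i" "0 < b $ i - x $ i" using True by (auto simp: mem_box_cart)
    from this[THEN flat_fun_scaled_tendsto_1]
    show "(\<lambda>n. flat_fun 0 (real n * x $ i + - real n * a $ i)) \<longlonglongrightarrow> 1"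
      "(\<lambda>n. flat_fun 0 (- real n * x $ i + real n * b $ i)) \<longlonglongrightarrow> 1"
      by (simp_all add: algebra_simps)
  qed
  have "(\<lambda>n. box_bump n a b x) \<longlonglongrightarrow> (\<Prod>i\<in>(UNIV :: 'n set). of_real 1 * of_real 1)"
    unfolding box_bump_def by (rule tendsto_prod) (rule lim)
  with True show ?thesis by simp
next
  case False
  then have "box_bump n a b x = 0" for n using norm_box_bump_le[of n a b x] by simp
  with False show ?thesis by simp
qed

lemma closed_dual_group: "closed (dual_group T)"
proof -
  have "dual_group T = (\<Inter>i\<in>T. (\<lambda>\<xi>. \<xi> $ i) -` \<int>)" by (auto simp: dual_group_def)
  then show ?thesis
    by (auto intro!: closed_INT closed_vimage closed_Ints continuous_intros)
qed

lemma box_bump_mem_Cc_dual: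
  "(\<lambda>\<xi>. if \<xi> \<in> dual_group T then box_bump n a b \<xi> else 0) \<in> lf_space (Cc_dual T)"
  unfolding mem_Cc_dual_iff
proof (intro conjI allI exI[of _ "cbox a b \<inter> dual_group T"] impI)
  fix \<xi> assume "\<xi> \<notin> cbox a b \<inter> dual_group T"
  then have "\<xi> \<notin> dual_group T \<or> \<xi> \<notin> box a b" using box_subset_cbox[of a b] by blast
  then show "(if \<xi> \<in> dual_group T then box_bump n a b \<xi> else 0) = 0"
    using norm_box_bump_le[of n a b \<xi>] by auto
qed (auto intro!: diff_along_restrict diff_along_box_bump dual_group_invariant
       closed_dual_group compact_Int_closed)

section \<open>The fundamental lemma of the calculus of variations\<close>

text \<open>Bumps converge boundedly to indicator functions of boxes, so the integral of \<open>F\<close> over every box is zero.  Boxes are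
  stable under intersection and generate the Borel sets, hence after a cut-off to a large box all integrals over Borel
  sets vanish.\<close>

lemma AE_eq_0_if_integral_test_eq_0:
  fixes F :: "real^'n::finite \<Rightarrow> complex"
  assumes sets_M [measurable_cong]: "sets M = sets borel"
    and F [measurable]: "F \<in> borel_measurable M"
    and int: "\<And>K. compact K \<Longrightarrow> integrable M (\<lambda>\<xi>. indicator K \<xi> *\<^sub>R F \<xi>)"
    and F0: "\<And>\<xi>. \<xi> \<notin> dual_group T \<Longrightarrow> F \<xi> = 0"
    and test: "\<And>g. g \<in> lf_space (Cc_dual T) \<Longrightarrow> (\<integral>\<xi>. g \<xi> * F \<xi> \<partial>M) = 0"
  shows "AE \<xi> in M. F \<xi> = 0"
proof -
  have [simp]: "space M = UNIV" using sets_eq_imp_space_eq[OF sets_M] by simp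
  have box0: "(\<integral>\<xi>. indicator (box a b) \<xi> *\<^sub>R F \<xi> \<partial>M) = 0" for a b
  proof -
    have [measurable]: "box_bump n a b \<in> borel_measurable M" for n
      using diff_along_continuous[OF diff_along_box_bump, of UNIV n a b]
      by (metis borel_measurable_continuous_onI measurable_cong_sets sets_M)
    have "(\<lambda>n. \<integral>\<xi>. box_bump n a b \<xi> * F \<xi> \<partial>M) \<longlonglongrightarrow> (\<integral>\<xi>. indicator (box a b) \<xi> *\<^sub>R F \<xi> \<partial>M)"
    proof (rule integral_dominated_convergence[where w="\<lambda>\<xi>. norm (indicator (cbox a b) \<xi> *\<^sub>R F \<xi>)"])
      show "AE \<xi> in M. (\<lambda>n. box_bump n a b \<xi> * F \<xi>) \<longlonglongrightarrow> indicator (box a b) \<xi> *\<^sub>R F \<xi>"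
      proof (rule AE_I2)
        fix \<xi>
        show "(\<lambda>n. box_bump n a b \<xi> * F \<xi>) \<longlonglongrightarrow> indicator (box a b) \<xi> *\<^sub>R F \<xi>"
          using tendsto_mult_right[OF box_bump_tendsto[of a b \<xi>], of "F \<xi>"]
          by (cases "\<xi> \<in> box a b") simp_all
      qed
      show "AE \<xi> in M. norm (box_bump n a b \<xi> * F \<xi>) \<le> norm (indicator (cbox a b) \<xi> *\<^sub>R F \<xi>)" for n
      proof (rule AE_I2)
        fix \<xi>
        have "cmod (box_bump n a b \<xi>) \<le> indicator (cbox a b) \<xi>"
          using norm_box_bump_le[of n a b \<xi>] box_subset_cbox[of a b]
          by (cases "\<xi> \<in> box a b") (auto simp: subset_iff)
        then show "norm (box_bump n a b \<xi> * F \<xi>) \<le> norm (indicator (cbox a b) \<xi> *\<^sub>R F \<xi>)"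
          by (simp add: norm_mult mult_right_mono)
      qed
      show "integrable M (\<lambda>\<xi>. norm (indicator (cbox a b) \<xi> *\<^sub>R F \<xi>))"
        by (intro integrable_norm int) simp
    qed measurable
    moreover have "(\<integral>\<xi>. box_bump n a b \<xi> * F \<xi> \<partial>M) = 0" for n
    proof -
      have "(\<lambda>\<xi>. box_bump n a b \<xi> * F \<xi>) =
          (\<lambda>\<xi>. (if \<xi> \<in> dual_group T then box_bump n a b \<xi> else 0) * F \<xi>)"
        using F0 by auto
      then show ?thesis using test[OF box_bump_mem_Cc_dual[of T n a b]] by simp
    qed
    ultimately show ?thesis by (simp add: LIMSEQ_const_iff)
  qed
  define c where "c m = (\<chi> i::'n. real m)" for m
  have AE_box: "AE \<xi> in M. indicator (box (- c m) (c m)) \<xi> *\<^sub>R F \<xi> = 0" for m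
  proof -
    define Fm where "Fm \<xi> = indicator (box (- c m) (c m)) \<xi> *\<^sub>R F \<xi>" for \<xi>
    have Fm_int: "integrable M Fm"
    proof (rule Bochner_Integration.integrable_bound[OF int[of "cbox (- c m) (c m)"]])
      show "AE \<xi> in M. norm (Fm \<xi>) \<le> norm (indicator (cbox (- c m) (c m)) \<xi> *\<^sub>R F \<xi>)"
        using box_subset_cbox[of "- c m" "c m"]
        by (intro AE_I2) (auto simp: Fm_def indicator_def)
      show "Fm \<in> borel_measurable M"
        unfolding Fm_def[abs_def] using sets_M by measurable
    qed (rule compact_cbox)
    have zero: "(\<integral>\<xi>\<in>A. Fm \<xi> \<partial>M) = 0" if "A \<in> sets M" for A
    proof -
      let ?G = "range (\<lambda>(a, b). box a b :: (real^'n) set)"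
      have sets: "sets M = sigma_sets UNIV ?G"
        unfolding sets_M by (subst borel_eq_box) (simp add: sets_measure_of)
      have inter: "\<exists>u v. box a b \<inter> box a' b' = box u (v :: real^'n)" for a b a' b'
        by (rule exI[of _ "\<chi> i. max (a $ i) (a' $ i)"], rule exI[of _ "\<chi> i. min (b $ i) (b' $ i)"])
           (auto simp: mem_box_cart)
      have "Int_stable ?G"
        unfolding Int_stable_def using inter by (auto simp: image_iff)
      moreover have "?G \<subseteq> Pow UNIV" by simp
      moreover have "A \<in> sigma_sets UNIV ?G" using that sets by simp
      ultimately show ?thesis
      proof (induction rule: sigma_sets_induct_disjoint)
        case (basic A)
        then obtain a b where A: "A = box a b" by auto
        obtain u v where uv: "box a b \<inter> box (- c m) (c m) = box u v" using inter by blast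
        have "indicator A \<xi> *\<^sub>R Fm \<xi> = indicator (box u v) \<xi> *\<^sub>R F \<xi>" for \<xi>
          unfolding uv[symmetric] Fm_def A by (auto simp: indicator_def)
        then show ?case using box0 by (simp add: set_lebesgue_integral_def)
      next
        case (compl A)
        have A [measurable]: "A \<in> sets M" using compl sets by simp
        have "Fm \<xi> = indicator (UNIV - A) \<xi> *\<^sub>R Fm \<xi> + indicator A \<xi> *\<^sub>R Fm \<xi>" for \<xi>
          by (auto simp: indicator_def)
        then have "integral\<^sup>L M Fm = (\<integral>\<xi>\<in>UNIV - A. Fm \<xi> \<partial>M) + (\<integral>\<xi>\<in>A. Fm \<xi> \<partial>M)"
          unfolding set_lebesgue_integral_def
          by (subst Bochner_Integration.integral_add[symmetric])
             (auto intro!: integrable_mult_indicator Fm_int)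
        moreover have "integral\<^sup>L M Fm = 0" unfolding Fm_def[abs_def] by (rule box0)
        ultimately show ?case using compl by simp
      next
        case (union A)
        have "A i \<in> sets M" for i using union sets by auto
        then have "(\<integral>\<xi>\<in>(\<Union>i. A i). Fm \<xi> \<partial>M) = (\<Sum>i. \<integral>\<xi>\<in>A i. Fm \<xi> \<partial>M)"
          using union(1) unfolding set_integrable_def disjoint_family_on_def
          by (intro lebesgue_integral_countable_add)
             (auto simp: set_integrable_def intro!: integrable_mult_indicator Fm_int)
        then show ?case using union by simp
      qed (auto simp: set_lebesgue_integral_def)
    qed
    have "AE \<xi> in M. Re (Fm \<xi>) = 0"
    proof (rule density_unique_real)
      fix A assume A: "A \<in> sets M"
      then have "(\<integral>\<xi>\<in>A. Re (Fm \<xi>) \<partial>M) = Re (\<integral>\<xi>\<in>A. Fm \<xi> \<partial>M)"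
        unfolding set_lebesgue_integral_def
        by (subst integral_Re[symmetric]) (auto intro!: integrable_mult_indicator Fm_int)
      then show "(\<integral>\<xi>\<in>A. Re (Fm \<xi>) \<partial>M) = (\<integral>\<xi>\<in>A. 0 \<partial>M)"
        using zero[OF A] by (simp add: set_lebesgue_integral_def)
    qed (auto intro!: integrable_Re Fm_int)
    moreover have "AE \<xi> in M. Im (Fm \<xi>) = 0"
    proof (rule density_unique_real)
      fix A assume A: "A \<in> sets M"
      then have "(\<integral>\<xi>\<in>A. Im (Fm \<xi>) \<partial>M) = Im (\<integral>\<xi>\<in>A. Fm \<xi> \<partial>M)"
        unfolding set_lebesgue_integral_def
        by (subst integral_Im[symmetric]) (auto intro!: integrable_mult_indicator Fm_int)
      then show "(\<integral>\<xi>\<in>A. Im (Fm \<xi>) \<partial>M) = (\<integral>\<xi>\<in>A. 0 \<partial>M)"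
        using zero[OF A] by (simp add: set_lebesgue_integral_def)
    qed (auto intro!: integrable_Im Fm_int)
    ultimately show ?thesis
      unfolding Fm_def[symmetric] by eventually_elim (simp add: complex_eq_iff)
  qed
  then have "AE \<xi> in M. \<forall>m. indicator (box (- c m) (c m)) \<xi> *\<^sub>R F \<xi> = 0"
    by (simp only: AE_all_countable simp_thms)
  then show ?thesis
  proof eventually_elim
    case (elim \<xi>)
    obtain m where m: "norm \<xi> < real m" using reals_Archimedean2 by blast
    have "\<bar>\<xi> $ i\<bar> < real m" for i using component_le_norm_cart[of \<xi> i] m by linarith
    then have "\<xi> \<in> box (- c m) (c m)" by (auto simp: mem_box_cart c_def abs_less_iff minus_less_iff)
    with elim[rule_format, of m] show ?case by simp
  qed
qed

section \<open>Fields of distributions over the dual group\<close>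

lemma lf_dual_zero: "(\<lambda>_. 0) \<in> lf_dual F"
  by (simp add: lf_dual_def)

lemma lf_dual_scale_apply:
  "u \<in> lf_dual F \<Longrightarrow> f \<in> lf_space F \<Longrightarrow> u (\<lambda>x. c * f x) = c * u f"
  by (simp add: lf_dual_def)

lemma lf_dual_continuous_map: "u \<in> lf_dual F \<Longrightarrow> continuous_map (lf_topology F) euclidean u"
  by (simp add: lf_dual_def)

lemma lf_dual_eq_0_outside: "u \<in> lf_dual F \<Longrightarrow> f \<notin> lf_space F \<Longrightarrow> u f = 0"
  by (simp add: lf_dual_def)

lemma lf_dual_scale:
  assumes "u \<in> lf_dual F" shows "(\<lambda>f. c * u f) \<in> lf_dual F"
proof -
  have "continuous_map (lf_topology F) euclidean ((*) c \<circ> u)"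
    by (rule continuous_map_compose[OF lf_dual_continuous_map[OF assms]])
       (auto intro!: continuous_intros)
  then show ?thesis
    using assms by (auto simp: lf_dual_def algebra_simps o_def)
qed

lemma lf_dual_diff:
  assumes "u \<in> lf_dual F" "v \<in> lf_dual F"
  shows "(\<lambda>f. u f - v f) \<in> lf_dual F"
  using assms unfolding lf_dual_def
  by (auto simp: algebra_simps intro!: continuous_map_diff)

lemma sets_dual_haar [measurable_cong]: "sets (dual_haar T) = sets borel"
  by (simp add: dual_haar_def)

lemma space_dual_haar [simp]: "space (dual_haar T) = UNIV"
  by (simp add: dual_haar_def)

text \<open>The domination by \<open>q\<close> makes \<open>(v, \<xi>) \<mapsto> v (tilt \<xi> h)\<close> jointly continuous: \<open>q (tilt \<xi> h)\<close> is
  locally bounded in \<open>\<xi>\<close> and bounds the effect of a change of \<open>v\<close>, while a single \<open>v\<close> is continuous along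
  the curve of tilts.\<close>

locale dominated_Y_space =
  fixes Y :: "(real^'n::finite) set" and NY :: "(real^'n) functional \<Rightarrow> ennreal"
    and q :: "(real^'n \<Rightarrow> complex) \<Rightarrow> real"
  assumes embedded: "embedded_banach (Cc_Y Y) NY"
    and q_continuous: "continuous_map (lf_topology (Cc_Y Y)) euclideanreal q"
    and norm_apply_le: "h \<in> lf_space (Cc_Y Y) \<Longrightarrow> v \<in> Y_space Y NY \<Longrightarrow>
           cmod (v h) \<le> q h * enn2real (NY v)"
begin

lemma NY_0: "NY (\<lambda>_. 0) = 0"
  using embedded lf_dual_zero[of "Cc_Y Y"] unfolding embedded_banach_def by blast

lemma NY_scale: "v \<in> lf_dual (Cc_Y Y) \<Longrightarrow> NY (\<lambda>h. c * v h) = ennreal (cmod c) * NY v"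
  using embedded by (auto simp: embedded_banach_def)

lemma NY_add_le:
  "v \<in> lf_dual (Cc_Y Y) \<Longrightarrow> w \<in> lf_dual (Cc_Y Y) \<Longrightarrow> NY (\<lambda>h. v h + w h) \<le> NY v + NY w"
  using embedded by (auto simp: embedded_banach_def)

lemma Y_spaceD: "v \<in> Y_space Y NY \<Longrightarrow> v \<in> lf_dual (Cc_Y Y)" "v \<in> Y_space Y NY \<Longrightarrow> NY v < \<infinity>"
  by (auto simp: Y_space_def finite_part_def)

lemma NY_diff_le:
  assumes "v \<in> Y_space Y NY" "w \<in> Y_space Y NY"
  shows "NY (\<lambda>h. v h - w h) \<le> NY v + NY w"
proof -
  have "NY (\<lambda>h. v h + (- 1) * w h) \<le> NY v + NY (\<lambda>h. (- 1) * w h)"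
    by (intro NY_add_le lf_dual_scale Y_spaceD assms)
  also have "NY (\<lambda>h. (- 1) * w h) = NY w"
    using NY_scale[OF Y_spaceD(1)[OF assms(2)], of "- 1"] by simp
  finally show ?thesis by simp
qed

lemma Y_space_diff:
  assumes "v \<in> Y_space Y NY" "w \<in> Y_space Y NY"
  shows "(\<lambda>h. v h - w h) \<in> Y_space Y NY"
proof -
  have "NY v + NY w < \<infinity>" using assms[THEN Y_spaceD(2)] by simp
  with NY_diff_le[OF assms] have "NY (\<lambda>h. v h - w h) < \<infinity>" by (rule le_less_trans)
  then show ?thesis
    using assms[THEN Y_spaceD(1)] by (simp add: Y_space_def finite_part_def lf_dual_diff)
qed

lemma ext_dist_triangle:
  assumes "u \<in> Y_space Y NY" "v \<in> Y_space Y NY" "w \<in> Y_space Y NY"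
  shows "ext_dist NY v w \<le> ext_dist NY u v + ext_dist NY u w"
proof -
  have uv: "(\<lambda>h. u h - v h) \<in> Y_space Y NY" and uw: "(\<lambda>h. u h - w h) \<in> Y_space Y NY"
    using assms by (auto intro: Y_space_diff)
  have "NY (\<lambda>h. v h - w h) \<le> NY (\<lambda>h. u h - w h) + NY (\<lambda>h. u h - v h)"
    using NY_diff_le[OF uw uv] by simp
  then have "enn2real (NY (\<lambda>h. v h - w h)) \<le> enn2real (NY (\<lambda>h. u h - w h) + NY (\<lambda>h. u h - v h))"
    using Y_spaceD(2)[OF uv] Y_spaceD(2)[OF uw] by (intro enn2real_mono) auto
  then show ?thesis
    using Y_spaceD(2)[OF uv] Y_spaceD(2)[OF uw] by (simp add: ext_dist_def enn2real_plus)
qed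

lemma norm_apply_diff_le:
  assumes "v \<in> Y_space Y NY" "w \<in> Y_space Y NY" "h \<in> lf_space (Cc_Y Y)"
  shows "cmod (v h - w h) \<le> q h * ext_dist NY v w"
  using norm_apply_le[OF assms(3) Y_space_diff[OF assms(1,2)]] by (simp add: ext_dist_def)

lemma continuous_apply_tilt:
  assumes "v \<in> Y_space Y NY" "h \<in> lf_space (Cc_Y Y)"
  shows "continuous_on UNIV (\<lambda>\<xi>. v (tilt \<xi> h))"
  using continuous_map_compose[OF continuous_map_tilt[OF assms(2)]
      lf_dual_continuous_map[OF Y_spaceD(1)[OF assms(1)]]]
  by (simp add: o_def)

lemma continuous_q_tilt:
  assumes "h \<in> lf_space (Cc_Y Y)"
  shows "continuous_on UNIV (\<lambda>\<xi>. q (tilt \<xi> h))"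
  using continuous_map_compose[OF continuous_map_tilt[OF assms] q_continuous] by (simp add: o_def)

end

locale distribution_field = dominated_Y_space Y NY q
  for Y :: "(real^'n::finite) set" and NY q +
  fixes T :: "'n set" and U :: "real^'n \<Rightarrow> (real^'n) functional"
  assumes field: "U \<in> L1loc_dual_Y T Y NY"
begin

lemma field_mem: "\<xi> \<in> dual_group T \<Longrightarrow> U \<xi> \<in> Y_space Y NY"
  using field by (simp add: L1loc_dual_Y_def)

lemma field_eq_0: "\<xi> \<notin> dual_group T \<Longrightarrow> U \<xi> = (\<lambda>_. 0)"
  using field by (simp add: L1loc_dual_Y_def)

lemma field_approx:
  obtains s where "\<And>k::nat. simple_function (dual_haar T) (s k)"
    "\<And>k \<xi>. \<xi> \<in> dual_group T \<Longrightarrow> s k \<xi> \<in> Y_space Y NY"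
    "\<And>\<xi>. \<xi> \<in> dual_group T \<Longrightarrow> (\<lambda>k. ext_dist NY (s k \<xi>) (U \<xi>)) \<longlonglongrightarrow> 0"
proof -
  have "\<exists>s. (\<forall>k::nat. simple_function (dual_haar T) (s k) \<and> (\<forall>\<xi>\<in>dual_group T. s k \<xi> \<in> Y_space Y NY)) \<and>
      (\<forall>\<xi>\<in>dual_group T. (\<lambda>k. ext_dist NY (s k \<xi>) (U \<xi>)) \<longlonglongrightarrow> 0)"
    using field by (simp add: L1loc_dual_Y_def)
  then show ?thesis using that by blast
qed

text \<open>The approximating simple functions take finitely many values \<open>v\<close>, and each \<open>\<xi> \<mapsto> v (tilt \<xi> h)\<close> is continuous.\<close>

lemma borel_measurable_apply_tilt:
  assumes h: "h \<in> lf_space (Cc_Y Y)"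
  shows "(\<lambda>\<xi>. U \<xi> (tilt \<xi> h)) \<in> borel_measurable borel"
proof -
  obtain s where simple: "\<And>k::nat. simple_function (dual_haar T) (s k)"
    and s: "\<And>k \<xi>. \<xi> \<in> dual_group T \<Longrightarrow> s k \<xi> \<in> Y_space Y NY"
    and lim: "\<And>\<xi>. \<xi> \<in> dual_group T \<Longrightarrow> (\<lambda>k. ext_dist NY (s k \<xi>) (U \<xi>)) \<longlonglongrightarrow> 0"
    using field_approx by metis
  define A where "A k \<xi> = (\<Sum>v\<in>s k ` dual_group T.
    indicator (s k -` {v} \<inter> dual_group T) \<xi> *\<^sub>R v (tilt \<xi> h))" for k \<xi>
  have fin: "finite (s k ` dual_group T)" for k
    using simple_functionD(1)[OF simple[of k]] by (auto elim: finite_subset[rotated])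
  have A_eq: "A k \<xi> = s k \<xi> (tilt \<xi> h)" if "\<xi> \<in> dual_group T" for k \<xi>
  proof -
    have "A k \<xi> = (\<Sum>v\<in>s k ` dual_group T. if v = s k \<xi> then v (tilt \<xi> h) else 0)"
      unfolding A_def using that by (intro sum.cong) (auto simp: indicator_def)
    then show ?thesis using fin that by simp
  qed
  have "A k \<in> borel_measurable borel" for k
    unfolding A_def
  proof (intro borel_measurable_sum borel_measurable_scaleR borel_measurable_indicator sets.Int)
    fix v assume "v \<in> s k ` dual_group T"
    then have "v \<in> Y_space Y NY" using s by auto
    from continuous_apply_tilt[OF this h] show "(\<lambda>\<xi>. v (tilt \<xi> h)) \<in> borel_measurable borel"
      by (rule borel_measurable_continuous_onI)
    show "s k -` {v} \<in> sets borel"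
      using simple_functionD(2)[OF simple[of k], of "{v}"] by (simp add: sets_dual_haar)
    show "dual_group T \<in> sets borel" by (intro borel_closed closed_dual_group)
  qed
  moreover have "(\<lambda>k. A k \<xi>) \<longlonglongrightarrow> U \<xi> (tilt \<xi> h)" for \<xi>
  proof (cases "\<xi> \<in> dual_group T")
    case True
    have le: "norm (A k \<xi> - U \<xi> (tilt \<xi> h)) \<le> q (tilt \<xi> h) * ext_dist NY (s k \<xi>) (U \<xi>)" for k
      using norm_apply_diff_le[OF s[OF True] field_mem[OF True] tilt_mem_Cc_Y[OF h]]
      by (simp only: A_eq[OF True])
    have "(\<lambda>k. q (tilt \<xi> h) * ext_dist NY (s k \<xi>) (U \<xi>)) \<longlonglongrightarrow> 0"
      by (rule tendsto_mult_right_zero[OF lim[OF True]])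
    with always_eventually[OF allI[OF le]]
    have "(\<lambda>k. A k \<xi> - U \<xi> (tilt \<xi> h)) \<longlonglongrightarrow> 0"
      by (rule Lim_null_comparison)
    then show ?thesis by (simp add: LIM_zero_iff)
  next
    case False
    then show ?thesis by (simp add: A_def field_eq_0)
  qed
  ultimately show ?thesis
    by (rule borel_measurable_LIMSEQ_metric)
qed

lemma integrable_apply_tilt:
  assumes h: "h \<in> lf_space (Cc_Y Y)" and K: "compact K"
  shows "integrable (dual_haar T) (\<lambda>\<xi>. indicator K \<xi> *\<^sub>R U \<xi> (tilt \<xi> h))"
proof (rule integrableI_bounded)
  have [measurable]: "(\<lambda>\<xi>. U \<xi> (tilt \<xi> h)) \<in> borel_measurable borel"
    by (rule borel_measurable_apply_tilt[OF h])
  have [measurable]: "K \<in> sets borel" using K by (simp add: borel_compact)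
  show meas: "(\<lambda>\<xi>. indicator K \<xi> *\<^sub>R U \<xi> (tilt \<xi> h)) \<in> borel_measurable (dual_haar T)"
    by measurable
  have "bounded ((\<lambda>\<xi>. q (tilt \<xi> h)) ` K)"
    using continuous_q_tilt[OF h] K
    by (intro compact_imp_bounded compact_continuous_image) (auto elim: continuous_on_subset)
  then obtain C where C: "0 < C" "\<And>\<xi>. \<xi> \<in> K \<Longrightarrow> q (tilt \<xi> h) \<le> C"
    unfolding bounded_pos by fastforce
  let ?K = "K \<inter> dual_group T"
  \<comment> \<open>Dividing by \<open>C\<close> first avoids pulling a constant out of the integral of \<open>\<xi> \<mapsto> NY (U \<xi>)\<close>, which would
    require measurability of that function.\<close>
  have "(\<integral>\<^sup>+\<xi>. ennreal (norm (indicator K \<xi> *\<^sub>R U \<xi> (tilt \<xi> h)) / C) \<partial>dual_haar T)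
      \<le> (\<integral>\<^sup>+\<xi>\<in>?K. NY (U \<xi>) \<partial>dual_haar T)"
  proof (intro nn_integral_mono)
    fix \<xi>
    show "ennreal (norm (indicator K \<xi> *\<^sub>R U \<xi> (tilt \<xi> h)) / C) \<le> NY (U \<xi>) * indicator ?K \<xi>"
    proof (cases "\<xi> \<in> ?K")
      case True
      then have U: "U \<xi> \<in> Y_space Y NY" using field_mem by simp
      have "cmod (U \<xi> (tilt \<xi> h)) \<le> q (tilt \<xi> h) * enn2real (NY (U \<xi>))"
        by (intro norm_apply_le tilt_mem_Cc_Y h U)
      also have "\<dots> \<le> C * enn2real (NY (U \<xi>))" using C True by (intro mult_right_mono) auto
      finally have "cmod (U \<xi> (tilt \<xi> h)) / C \<le> enn2real (NY (U \<xi>))"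
        using C by (simp add: divide_le_eq mult.commute)
      then have "ennreal (cmod (U \<xi> (tilt \<xi> h)) / C) \<le> ennreal (enn2real (NY (U \<xi>)))"
        by (rule ennreal_leI)
      also have "\<dots> = NY (U \<xi>)" using Y_spaceD(2)[OF U] by simp
      finally show ?thesis using True by simp
    next
      case False
      then show ?thesis by (auto simp: field_eq_0 indicator_def)
    qed
  qed
  also have "\<dots> < \<infinity>"
    using field K compact_Int_closed[OF K closed_dual_group] unfolding L1loc_dual_Y_def by blast
  finally have fin: "(\<integral>\<^sup>+\<xi>. ennreal (norm (indicator K \<xi> *\<^sub>R U \<xi> (tilt \<xi> h)) / C) \<partial>dual_haar T) < \<infinity>" .
  have "(\<integral>\<^sup>+\<xi>. ennreal (norm (indicator K \<xi> *\<^sub>R U \<xi> (tilt \<xi> h))) \<partial>dual_haar T) =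
      (\<integral>\<^sup>+\<xi>. ennreal C * ennreal (norm (indicator K \<xi> *\<^sub>R U \<xi> (tilt \<xi> h)) / C) \<partial>dual_haar T)"
    using C by (intro nn_integral_cong) (simp flip: ennreal_mult')
  also have "\<dots> = ennreal C * (\<integral>\<^sup>+\<xi>. ennreal (norm (indicator K \<xi> *\<^sub>R U \<xi> (tilt \<xi> h)) / C) \<partial>dual_haar T)"
    using meas by (intro nn_integral_cmult) measurable
  also have "\<dots> < \<infinity>" using fin by (simp add: ennreal_mult_less_top)
  finally show "(\<integral>\<^sup>+\<xi>. ennreal (norm (indicator K \<xi> *\<^sub>R U \<xi> (tilt \<xi> h))) \<partial>dual_haar T) < \<infinity>" .
qed

lemma integrable_test_mult_apply_tilt:
  assumes g: "g \<in> lf_space (Cc_dual T)" and h: "h \<in> lf_space (Cc_Y Y)"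
  shows "integrable (dual_haar T) (\<lambda>\<xi>. g \<xi> * U \<xi> (tilt \<xi> h))"
proof -
  from g obtain K where d: "diff_along (dual_dirs T) (dual_group T) 0 g"
    and K: "compact K" "K \<subseteq> dual_group T" "\<And>\<xi>. \<xi> \<notin> K \<Longrightarrow> g \<xi> = 0"
    unfolding mem_Cc_dual_iff by blast
  then have cont: "continuous_on (dual_group T) g" by simp
  have "(\<lambda>\<xi>. indicator (dual_group T) \<xi> *\<^sub>R g \<xi>) \<in> borel_measurable borel"
    by (intro borel_measurable_continuous_on_indicator cont borel_closed closed_dual_group)
  also have "(\<lambda>\<xi>. indicator (dual_group T) \<xi> *\<^sub>R g \<xi>) = g"
    using K by (auto simp: indicator_def fun_eq_iff)
  finally have [measurable]: "g \<in> borel_measurable borel" .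
  have [measurable]: "(\<lambda>\<xi>. U \<xi> (tilt \<xi> h)) \<in> borel_measurable borel"
    by (rule borel_measurable_apply_tilt[OF h])
  have "bounded (g ` K)"
    using cont K by (intro compact_imp_bounded compact_continuous_image) (auto elim: continuous_on_subset)
  then obtain C where C: "0 < C" "\<And>\<xi>. \<xi> \<in> K \<Longrightarrow> cmod (g \<xi>) \<le> C"
    unfolding bounded_pos by fastforce
  show ?thesis
  proof (rule Bochner_Integration.integrable_bound)
    show "integrable (dual_haar T) (\<lambda>\<xi>. C *\<^sub>R (indicator K \<xi> *\<^sub>R U \<xi> (tilt \<xi> h)))"
      by (intro integrable_scaleR_right integrable_apply_tilt h K(1))
    show "AE \<xi> in dual_haar T. norm (g \<xi> * U \<xi> (tilt \<xi> h)) \<le> norm (C *\<^sub>R (indicator K \<xi> *\<^sub>R U \<xi> (tilt \<xi> h)))"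
    proof (rule AE_I2)
      fix \<xi>
      show "norm (g \<xi> * U \<xi> (tilt \<xi> h)) \<le> norm (C *\<^sub>R (indicator K \<xi> *\<^sub>R U \<xi> (tilt \<xi> h)))"
        using C K(3) by (cases "\<xi> \<in> K") (auto simp: norm_mult intro!: mult_right_mono)
    qed
  qed measurable
qed

text \<open>A Lindelof argument.  The sets \<open>V (d, r, m)\<close> are the traces on the dual group of countably many balls around the points of
  a dense set, pulled back along \<open>\<xi> \<mapsto> (U \<xi>, \<xi>, a \<xi>)\<close>.  Every point at which the identity fails for some
  \<open>h\<close> lies in such a set on which it fails for this same \<open>h\<close> throughout; sets of that kind are null and countable in
  number.\<close>

lemma AE_all_test_functions:
  fixes a :: "real^'n \<Rightarrow> complex" and c :: "(real^'n \<Rightarrow> complex) \<Rightarrow> complex"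
  assumes each: "\<And>h. h \<in> lf_space (Cc_Y Y) \<Longrightarrow>
    AE \<xi> in M. \<xi> \<in> dual_group T \<longrightarrow> U \<xi> (tilt \<xi> h) = c h * a \<xi>"
  shows "AE \<xi> in M. \<xi> \<in> dual_group T \<longrightarrow> (\<forall>h\<in>lf_space (Cc_Y Y). U \<xi> (tilt \<xi> h) = c h * a \<xi>)"
proof -
  obtain s where simple: "\<And>k::nat. simple_function (dual_haar T) (s k)"
    and s: "\<And>k \<xi>. \<xi> \<in> dual_group T \<Longrightarrow> s k \<xi> \<in> Y_space Y NY"
    and lim: "\<And>\<xi>. \<xi> \<in> dual_group T \<Longrightarrow> (\<lambda>k. ext_dist NY (s k \<xi>) (U \<xi>)) \<longlonglongrightarrow> 0"
    using field_approx by metis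
  define D where "D = (\<Union>k. s k ` dual_group T)"
  have "countable (s k ` dual_group T)" for k
    by (rule countable_subset[OF _ countable_finite[OF simple_functionD(1)[OF simple[of k]]]]) auto
  then have D: "countable D" unfolding D_def by simp
  have DY: "D \<subseteq> Y_space Y NY" using s by (auto simp: D_def)
  obtain Q :: "((real^'n) \<times> complex) set" where Q: "countable Q"
    "\<And>S. open S \<Longrightarrow> S \<noteq> {} \<Longrightarrow> \<exists>r\<in>Q. r \<in> S"
    by (rule countable_dense_setE) blast
  define V where "V = (\<lambda>(d, r, m). {\<xi> \<in> dual_group T.
      ext_dist NY d (U \<xi>) < inverse (real (Suc m)) \<and> dist (\<xi>, a \<xi>) r < inverse (real (Suc m))})"
  define bad where "bad h = {\<xi> \<in> dual_group T. U \<xi> (tilt \<xi> h) \<noteq> c h * a \<xi>}" for h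
  define I where "I = {t \<in> D \<times> Q \<times> (UNIV :: nat set). \<exists>h\<in>lf_space (Cc_Y Y). V t \<subseteq> bad h}"
  have "countable I"
    by (rule countable_subset[of _ "D \<times> Q \<times> UNIV"]) (auto simp: I_def D Q)
  moreover have "AE \<xi> in M. \<xi> \<notin> V t" if "t \<in> I" for t
  proof -
    from that obtain h where h: "h \<in> lf_space (Cc_Y Y)" "V t \<subseteq> bad h" by (auto simp: I_def)
    from each[OF h(1)] show ?thesis
      by eventually_elim (use h(2) in \<open>auto simp: bad_def\<close>)
  qed
  ultimately have AE_V: "AE \<xi> in M. \<forall>t\<in>I. \<xi> \<notin> V t"
    by (simp add: AE_ball_countable)
  have cover: "\<exists>t\<in>I. \<xi>0 \<in> V t" if h: "h \<in> lf_space (Cc_Y Y)" and \<xi>0: "\<xi>0 \<in> bad h" for \<xi>0 h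
  proof (rule ccontr)
    \<comment> \<open>If no ball around the image of \<open>\<xi>0\<close> consists of violations for \<open>h\<close>, then points without violation
      converge to \<open>\<xi>0\<close>, and continuity carries the identity over to \<open>\<xi>0\<close>.\<close>
    assume none: "\<not> (\<exists>t\<in>I. \<xi>0 \<in> V t)"
    have dual: "\<xi>0 \<in> dual_group T" using \<xi>0 by (simp add: bad_def)
    have "\<exists>\<xi>\<in>dual_group T - bad h. ext_dist NY (U \<xi>) (U \<xi>0) \<le> 2 * inverse (real (Suc m)) \<and>
        dist (\<xi>, a \<xi>) (\<xi>0, a \<xi>0) \<le> 2 * inverse (real (Suc m))" for m
    proof -
      have "\<forall>\<^sub>F k in sequentially. ext_dist NY (s k \<xi>0) (U \<xi>0) < inverse (real (Suc m))"
        using lim[OF dual] by (rule order_tendstoD) simp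
      then obtain k where "ext_dist NY (s k \<xi>0) (U \<xi>0) < inverse (real (Suc m))"
        by (auto simp: eventually_sequentially)
      then obtain d where d: "d \<in> D" "ext_dist NY d (U \<xi>0) < inverse (real (Suc m))"
        using dual by (auto simp: D_def)
      have "\<exists>r\<in>Q. r \<in> ball (\<xi>0, a \<xi>0) (inverse (real (Suc m)))"
        by (rule Q(2)) (auto simp del: of_nat_Suc)
      then obtain r where r: "r \<in> Q" "dist (\<xi>0, a \<xi>0) r < inverse (real (Suc m))"
        by auto
      have "\<xi>0 \<in> V (d, r, m)" using d r dual by (simp add: V_def)
      with none have "(d, r, m) \<notin> I" by blast
      then have "\<not> V (d, r, m) \<subseteq> bad h" using d r h by (auto simp: I_def)
      then obtain \<xi> where \<xi>: "\<xi> \<in> V (d, r, m)" "\<xi> \<notin> bad h" by blast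
      then have \<xi>d: "\<xi> \<in> dual_group T" by (simp add: V_def)
      have "ext_dist NY (U \<xi>) (U \<xi>0) \<le> ext_dist NY d (U \<xi>) + ext_dist NY d (U \<xi>0)"
        using d DY field_mem dual \<xi>d by (intro ext_dist_triangle) auto
      moreover have "dist (\<xi>, a \<xi>) (\<xi>0, a \<xi>0) \<le> dist (\<xi>, a \<xi>) r + dist (\<xi>0, a \<xi>0) r"
        by (rule dist_triangle2)
      ultimately show ?thesis
        using \<xi> d r \<xi>d by (intro bexI[of _ \<xi>]) (auto simp: V_def)
    qed
    then obtain x where x: "\<And>m. x m \<in> dual_group T" "\<And>m. x m \<notin> bad h"
      "\<And>m. ext_dist NY (U (x m)) (U \<xi>0) \<le> 2 * inverse (real (Suc m))"
      "\<And>m. dist (x m, a (x m)) (\<xi>0, a \<xi>0) \<le> 2 * inverse (real (Suc m))"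
      by (metis DiffE)
    have two: "(\<lambda>m. 2 * inverse (real (Suc m))) \<longlonglongrightarrow> 0"
      using tendsto_mult[OF tendsto_const LIMSEQ_inverse_real_of_nat, of 2] by simp
    have "(\<lambda>m. dist (x m, a (x m)) (\<xi>0, a \<xi>0)) \<longlonglongrightarrow> 0"
      by (rule tendsto_sandwich[OF _ _ tendsto_const two]) (intro always_eventually allI zero_le_dist x(4))+
    then have "(\<lambda>m. (x m, a (x m))) \<longlonglongrightarrow> (\<xi>0, a \<xi>0)" by (subst tendsto_dist_iff)
    from tendsto_fst[OF this] tendsto_snd[OF this]
    have x_lim: "x \<longlonglongrightarrow> \<xi>0" and a_lim: "(\<lambda>m. a (x m)) \<longlonglongrightarrow> a \<xi>0" by simp_all
    have ext_lim: "(\<lambda>m. ext_dist NY (U (x m)) (U \<xi>0)) \<longlonglongrightarrow> 0"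
      by (rule tendsto_sandwich[OF _ _ tendsto_const two])
         (simp add: ext_dist_def, intro always_eventually allI x(3))
    have at_x: "(\<lambda>m. f (x m)) \<longlonglongrightarrow> f \<xi>0" if "continuous_on UNIV f"
      for f :: "real^'n \<Rightarrow> 'c::topological_space"
      using continuous_on_tendsto_compose[OF that x_lim] by simp
    have le: "norm (U (x m) (tilt (x m) h) - U \<xi>0 (tilt (x m) h)) \<le>
        q (tilt (x m) h) * ext_dist NY (U (x m)) (U \<xi>0)" for m
      by (rule norm_apply_diff_le[OF field_mem[OF x(1)] field_mem[OF dual] tilt_mem_Cc_Y[OF h]])
    have "(\<lambda>m. q (tilt (x m) h) * ext_dist NY (U (x m)) (U \<xi>0)) \<longlonglongrightarrow> 0"
      using tendsto_mult[OF at_x[OF continuous_q_tilt[OF h]] ext_lim] by simp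
    with always_eventually[OF allI[OF le]]
    have "(\<lambda>m. U (x m) (tilt (x m) h) - U \<xi>0 (tilt (x m) h)) \<longlonglongrightarrow> 0"
      by (rule Lim_null_comparison)
    from tendsto_add[OF this at_x[OF continuous_apply_tilt[OF field_mem[OF dual] h]]]
    have "(\<lambda>m. U (x m) (tilt (x m) h)) \<longlonglongrightarrow> U \<xi>0 (tilt \<xi>0 h)" by simp
    moreover have "U (x m) (tilt (x m) h) = c h * a (x m)" for m
      using x(1,2)[of m] by (simp add: bad_def)
    moreover have "(\<lambda>m. c h * a (x m)) \<longlonglongrightarrow> c h * a \<xi>0"
      by (intro tendsto_intros a_lim)
    ultimately have "U \<xi>0 (tilt \<xi>0 h) = c h * a \<xi>0" by (auto dest: LIMSEQ_unique)
    with \<xi>0 show False by (simp add: bad_def)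
  qed
  from AE_V show ?thesis
  proof eventually_elim
    case (elim \<xi>)
    then have "\<xi> \<notin> bad h" if "h \<in> lf_space (Cc_Y Y)" for h using cover[OF that] by blast
    then show ?case by (simp add: bad_def)
  qed
qed

end

section \<open>The support theorem\<close>

lemma exp_mult_tensor:
  assumes "u0 \<in> lf_dual (Cc_dual T)" "g \<in> lf_space (Cc_dual T)"
  shows "exp_mult \<nu> u0 (\<lambda>(\<xi>, y). g \<xi> * tilt \<xi> h y) = u0 g * integral\<^sup>L \<nu> h"
proof -
  have "complex_of_real (exp (- 2 * pi * (y \<bullet> \<xi>))) * of_real (exp (2 * pi * (y \<bullet> \<xi>))) = 1" for y \<xi> :: "real^'n"
    by (simp flip: of_real_mult exp_add)
  then have "complex_of_real (exp (- 2 * pi * (y \<bullet> \<xi>))) * (g \<xi> * tilt \<xi> h y) = h y * g \<xi>" for y \<xi>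
    unfolding tilt_def by (metis (no_types, lifting) mult.assoc mult.commute mult.left_neutral)
  then have "exp_mult \<nu> u0 (\<lambda>(\<xi>, y). g \<xi> * tilt \<xi> h y) = (\<integral>y. u0 (\<lambda>\<xi>. h y * g \<xi>) \<partial>\<nu>)"
    unfolding exp_mult_def by (simp only: prod.case)
  also have "\<dots> = (\<integral>y. h y * u0 g \<partial>\<nu>)"
    by (simp only: lf_dual_scale_apply[OF assms])
  finally show ?thesis by (simp add: mult.commute)
qed

lemma exp_dist_eq: "exp_dist Y \<nu> \<xi> h = (if h \<in> lf_space (Cc_Y Y) then integral\<^sup>L \<nu> (tilt (- \<xi>) h) else 0)"
  by (simp add: exp_dist_def tilt_def)

lemma closed_dual_group_nonneg: "closed (dual_group_nonneg T)"
proof -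
  have "dual_group_nonneg T = dual_group T \<inter> (\<Inter>i. {\<xi>. 0 \<le> \<xi> $ i})"
    by (auto simp: dual_group_nonneg_def)
  then show ?thesis
    by (auto intro!: closed_Int closed_dual_group closed_INT closed_Collect_le continuous_intros)
qed

theorem proposition7:
  fixes T :: "'n::finite set"
    and Y :: "(real^'n) set"
    and \<nu> :: "(real^'n) measure"
    and NY :: "(real^'n) functional \<Rightarrow> ennreal"
    and NX :: "(real^'n) functional \<Rightarrow> ennreal"
    and q :: "(real^'n \<Rightarrow> complex) \<Rightarrow> real"
  assumes "open Y" and "connected Y" and "Y \<subseteq> {y. \<forall>i. 0 < y $ i}"
    and "smooth_positive_density Y \<nu>"
    and "embedded_banach (Cc_Y Y) NY"
    and "embedded_banach (S_dual T) NX"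
    and "locally_integrable_dists T NX"
    and "continuous_map (lf_topology (Cc_Y Y)) euclideanreal q"
    and "\<And>h. h \<in> lf_space (Cc_Y Y) \<Longrightarrow> 0 \<le> q h"
    and "q (\<lambda>_. 0) = 0"
    and "\<And>h v. h \<in> lf_space (Cc_Y Y) \<Longrightarrow> v \<in> Y_space Y NY \<Longrightarrow>
           cmod (v h) \<le> q h * enn2real (NY v)"
    and "\<And>\<xi>. \<xi> \<in> dual_group T - dual_group_nonneg T \<Longrightarrow> rho Y \<nu> NY \<xi> = \<infinity>"
  shows "\<forall>u \<in> A_X_space T Y \<nu> NY NX. \<forall>u0. is_u0 T Y \<nu> u u0 \<longrightarrow>
           dist_support T u0 \<subseteq> dual_group_nonneg T"
proof (intro ballI allI impI)
  fix u u0
  assume u: "u \<in> A_X_space T Y \<nu> NY NX" and u0: "is_u0 T Y \<nu> u u0"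
  note rho_infinite = assms(12)
  from u obtain U where U: "U \<in> L1loc_dual_Y T Y NY"
    and fU: "\<And>f. f \<in> lf_space (Cc_dual_prod T Y) \<Longrightarrow>
       fourier_dist T Y u f = (\<integral>\<xi>. U \<xi> (\<lambda>y. f (\<xi>, y)) \<partial>dual_haar T)"
    by (auto simp: A_X_space_def X_space_def Xi_Y_space_def)
  from u0 have u0_dual: "u0 \<in> lf_dual (Cc_dual T)"
    and fu0: "\<And>f. f \<in> lf_space (Cc_dual_prod T Y) \<Longrightarrow> fourier_dist T Y u f = exp_mult \<nu> u0 f"
    by (auto simp: is_u0_def)
  interpret distribution_field Y NY q T U
    by unfold_locales (use assms U in auto)
  have key: "u0 g * integral\<^sup>L \<nu> h = (\<integral>\<xi>. g \<xi> * U \<xi> (tilt \<xi> h) \<partial>dual_haar T)"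
    if g: "g \<in> lf_space (Cc_dual T)" and h: "h \<in> lf_space (Cc_Y Y)" for g h
  proof -
    have "U \<xi> (\<lambda>y. g \<xi> * tilt \<xi> h y) = g \<xi> * U \<xi> (tilt \<xi> h)" for \<xi>
      using lf_dual_scale_apply[OF Y_spaceD(1)[OF field_mem] tilt_mem_Cc_Y[OF h]] field_eq_0[of \<xi>]
      by (cases "\<xi> \<in> dual_group T") auto
    then show ?thesis
      using fU[OF tilt_tensor_mem_Cc_dual_prod[OF g h]] fu0[OF tilt_tensor_mem_Cc_dual_prod[OF g h]]
        exp_mult_tensor[OF u0_dual g, of \<nu> h] by simp
  qed
  \<comment> \<open>Otherwise all exponentials are the zero distribution, so \<open>\<rho>\<close> is identically zero; but it is infinite at
    the point all of whose coordinates are \<open>-1\<close>.\<close>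
  have "\<exists>h0\<in>lf_space (Cc_Y Y). integral\<^sup>L \<nu> h0 \<noteq> 0"
  proof (rule ccontr)
    assume "\<not> ?thesis"
    then have "exp_dist Y \<nu> \<xi> = (\<lambda>_. 0)" for \<xi>
      by (auto simp: exp_dist_eq tilt_mem_Cc_Y)
    then have "rho Y \<nu> NY \<xi> = 0" for \<xi> by (simp add: rho_def NY_0)
    moreover have "(\<chi> i. - 1) \<in> dual_group T - dual_group_nonneg T"
      by (auto simp: dual_group_def dual_group_nonneg_def)
    ultimately show False using rho_infinite by fastforce
  qed
  then obtain h0 where h0: "h0 \<in> lf_space (Cc_Y Y)" "integral\<^sup>L \<nu> h0 \<noteq> 0" by blast
  define a where "a \<xi> = U \<xi> (tilt \<xi> h0) / integral\<^sup>L \<nu> h0" for \<xi>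
  have AE_h: "AE \<xi> in dual_haar T. U \<xi> (tilt \<xi> h) - integral\<^sup>L \<nu> h * a \<xi> = 0"
    if h: "h \<in> lf_space (Cc_Y Y)" for h
  proof (rule AE_eq_0_if_integral_test_eq_0[where T=T])
    show "sets (dual_haar T) = sets borel" by (rule sets_dual_haar)
    show "(\<lambda>\<xi>. U \<xi> (tilt \<xi> h) - integral\<^sup>L \<nu> h * a \<xi>) \<in> borel_measurable (dual_haar T)"
      unfolding a_def measurable_cong_sets[OF sets_dual_haar refl]
      by (intro borel_measurable_diff borel_measurable_times borel_measurable_divide
          borel_measurable_const borel_measurable_apply_tilt h h0)
  next
    fix K :: "(real^'n) set" assume K: "compact K"
    have "indicator K \<xi> *\<^sub>R (U \<xi> (tilt \<xi> h) - integral\<^sup>L \<nu> h * a \<xi>) =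
        indicator K \<xi> *\<^sub>R U \<xi> (tilt \<xi> h) -
        (integral\<^sup>L \<nu> h / integral\<^sup>L \<nu> h0) * (indicator K \<xi> *\<^sub>R U \<xi> (tilt \<xi> h0))" for \<xi>
      by (simp add: a_def scaleR_diff_right)
    then show "integrable (dual_haar T) (\<lambda>\<xi>. indicator K \<xi> *\<^sub>R (U \<xi> (tilt \<xi> h) - integral\<^sup>L \<nu> h * a \<xi>))"
      using K h h0(1)
      by (simp only:) (intro Bochner_Integration.integrable_diff integrable_mult_right integrable_apply_tilt)
  next
    fix \<xi> assume "\<xi> \<notin> dual_group T"
    then show "U \<xi> (tilt \<xi> h) - integral\<^sup>L \<nu> h * a \<xi> = 0" by (simp add: a_def field_eq_0)
  next
    fix g assume g: "g \<in> lf_space (Cc_dual T)"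
    have "g \<xi> * (U \<xi> (tilt \<xi> h) - integral\<^sup>L \<nu> h * a \<xi>) = g \<xi> * U \<xi> (tilt \<xi> h) -
        (integral\<^sup>L \<nu> h / integral\<^sup>L \<nu> h0) * (g \<xi> * U \<xi> (tilt \<xi> h0))" for \<xi>
      by (simp add: a_def algebra_simps)
    then have "(\<integral>\<xi>. g \<xi> * (U \<xi> (tilt \<xi> h) - integral\<^sup>L \<nu> h * a \<xi>) \<partial>dual_haar T) =
        (\<integral>\<xi>. g \<xi> * U \<xi> (tilt \<xi> h) \<partial>dual_haar T) -
        (integral\<^sup>L \<nu> h / integral\<^sup>L \<nu> h0) * (\<integral>\<xi>. g \<xi> * U \<xi> (tilt \<xi> h0) \<partial>dual_haar T)"
      using integrable_test_mult_apply_tilt[OF g h] integrable_test_mult_apply_tilt[OF g h0(1)]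
      by simp
    also have "\<dots> = 0"
      using h0(2) unfolding key[OF g h, symmetric] key[OF g h0(1), symmetric] by simp
    finally show "(\<integral>\<xi>. g \<xi> * (U \<xi> (tilt \<xi> h) - integral\<^sup>L \<nu> h * a \<xi>) \<partial>dual_haar T) = 0" .
  qed
  have ae: "AE \<xi> in dual_haar T. \<xi> \<in> dual_group T \<longrightarrow>
      (\<forall>h\<in>lf_space (Cc_Y Y). U \<xi> (tilt \<xi> h) = integral\<^sup>L \<nu> h * a \<xi>)"
  proof (intro AE_all_test_functions)
    fix h assume "h \<in> lf_space (Cc_Y Y)"
    from AE_h[OF this] show "AE \<xi> in dual_haar T. \<xi> \<in> dual_group T \<longrightarrow> U \<xi> (tilt \<xi> h) = integral\<^sup>L \<nu> h * a \<xi>"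
      by eventually_elim simp
  qed
  \<comment> \<open>Replacing \<open>h\<close> by its tilt with parameter \<open>-\<xi>\<close> turns the identity into
    \<open>U \<xi> = a \<xi> \<cdot> exp_dist Y \<nu> \<xi>\<close>.\<close>
  have a_eq_0: "a \<xi> = 0" if \<xi>: "\<xi> \<in> dual_group T - dual_group_nonneg T"
    and all: "\<forall>h\<in>lf_space (Cc_Y Y). U \<xi> (tilt \<xi> h) = integral\<^sup>L \<nu> h * a \<xi>" for \<xi>
  proof (rule ccontr)
    assume a: "a \<xi> \<noteq> 0"
    have "exp_dist Y \<nu> \<xi> = (\<lambda>h. inverse (a \<xi>) * U \<xi> h)"
    proof
      fix h
      show "exp_dist Y \<nu> \<xi> h = inverse (a \<xi>) * U \<xi> h"
      proof (cases "h \<in> lf_space (Cc_Y Y)")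
        case True
        then have "U \<xi> h = integral\<^sup>L \<nu> (tilt (- \<xi>) h) * a \<xi>"
          using all tilt_mem_Cc_Y[OF True, of "- \<xi>"] by (metis tilt_uminus_cancel)
        with True a show ?thesis by (simp add: exp_dist_eq)
      next
        case False
        then show ?thesis
          using lf_dual_eq_0_outside[OF Y_spaceD(1)[OF field_mem]] \<xi> by (simp add: exp_dist_eq)
      qed
    qed
    then have "rho Y \<nu> NY \<xi> = ennreal (cmod (inverse (a \<xi>))) * NY (U \<xi>)"
      using NY_scale[OF Y_spaceD(1)[OF field_mem]] \<xi> by (simp add: rho_def)
    also have "\<dots> < \<infinity>" using Y_spaceD(2)[OF field_mem] \<xi> by (simp add: ennreal_mult_less_top)
    finally show False using rho_infinite[OF \<xi>] by simp
  qed
  show "dist_support T u0 \<subseteq> dual_group_nonneg T"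
  proof
    fix \<xi> assume \<xi>: "\<xi> \<in> dist_support T u0"
    show "\<xi> \<in> dual_group_nonneg T"
    proof (rule ccontr)
      assume "\<xi> \<notin> dual_group_nonneg T"
      moreover have "open (- dual_group_nonneg T)" using closed_dual_group_nonneg by auto
      ultimately obtain g where g: "g \<in> lf_space (Cc_dual T)"
        "closure {\<eta>. g \<eta> \<noteq> 0} \<subseteq> - dual_group_nonneg T" "u0 g \<noteq> 0"
        using \<xi> unfolding dist_support_def by blast
      have "AE \<eta> in dual_haar T. g \<eta> * U \<eta> (tilt \<eta> h0) = 0"
        using ae
      proof eventually_elim
        case (elim \<eta>)
        consider "\<eta> \<notin> dual_group T" | "\<eta> \<in> dual_group_nonneg T"
          | "\<eta> \<in> dual_group T - dual_group_nonneg T" by blast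
        then show ?case
        proof cases
          case 1
          then show ?thesis by (simp add: field_eq_0)
        next
          case 2
          then have "g \<eta> = 0" using subsetD[OF order_trans[OF closure_subset g(2)], of \<eta>] by auto
          then show ?thesis by simp
        next
          case 3
          with elim have "a \<eta> = 0" by (intro a_eq_0) auto
          then show ?thesis using h0(2) by (simp add: a_def)
        qed
      qed
      then have "(\<integral>\<eta>. g \<eta> * U \<eta> (tilt \<eta> h0) \<partial>dual_haar T) = 0" by (rule integral_eq_zero_AE)
      with key[OF g(1) h0(1)] g(3) h0(2) show False by simp
    qed
  qed
qed

end
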